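(* Let $\mathcal{R}$ be either (i) a countably infinite metrically complete standard distance monoid, or (ii) $(\mathbb{R}_{\ge0},\le,+,0)$, or (iii) $([0,1],\le,+_1,0)$ with $+_1$ truncated addition $r+_1s=\min\{r+s,1\}$. Let $\mathbb{U}=\mathbb{U}_{\mathcal{R}}$. Then on the monoid $\mathrm{IE}(\mathbb{U})$ of isometric self-embeddings of $\mathbb{U}$ one has $\tau_Z=\tau_{mpw}\subsetneq\tau_{pw}$; that is, $\tau_{mpw}$ is minimal amongst Hausdorff semigroup topologies on $\mathrm{IE}(\mathbb{U})$ and is strictly coarser than $\tau_{pw}$.
   Context: A distance monoid $\mathcal{R}=(R,\le,\oplus,0)$ is a commutative monoid with a total order such that $r\le r\oplus s$ and $s\le s'\Rightarrow s\oplus t\le s'\oplus t$. It is metrically complete if for all $s\le r$ in $R$ the set $\{t: r\le t\oplus s\}$ has a least element; standard if whenever $0\neq r\in R$ and $s<r$ there is $0\ne t\in R$ with $s\oplus t<r$. An $\mathcal{R}$-metric space is a set $X$ with $d:X^2\to R$ satisfying $d(x,y)=0\iff x=y$, symmetry, and $d(x,z)\le d(x,y)\oplus d(y,z)$. An $\mathcal{R}$-Urysohn space is an $\mathcal{R}$-metric space into which every finite $\mathcal{R}$-metric space isometrically embeds and in which every isometry between finite subspaces extends to a global isometry. For countable $\mathcal{R}$, $\mathbb{U}_{\mathcal{R}}$ is the (unique up to isometry) countable $\mathcal{R}$-Urysohn space; $\mathbb{U}_{\mathbb{R}}$ is the real Urysohn space (the completion of the rational Urysohn space) and $\mathbb{U}_{[0,1]}$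 the real Urysohn sphere (completion of the rational Urysohn sphere, universal and homogeneous for metric spaces of diameter $\le1$). $\tau_{pw}$ is the product topology on $\mathbb{U}^{\mathbb{U}}$ with $\mathbb{U}$ discrete, restricted to $\mathrm{IE}(\mathbb{U})$. $\tau_{mpw}$ is the product topology on $\mathbb{U}^{\mathbb{U}}$ with $\mathbb{U}$ carrying the metric topology (basis: balls $B_\epsilon(a)=\{b:d(a,b)<\epsilon\}$, $0\ne\epsilon\in R$), restricted to $\mathrm{IE}(\mathbb{U})$. $\tau_Z$ is the semigroup Zariski topology on $\mathrm{IE}(\mathbb{U})$: generated by solution sets of inequalities $\lambda_n s\cdots\lambda_1 s\lambda_0\ne\eta_m s\cdots\eta_1s\eta_0$ with parameters $\lambda_i,\eta_j\in\mathrm{IE}(\mathbb{U})$. *)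

theory Defs
  imports "HOL-Analysis.Analysis" "HOL-Algebra.Group"
begin

section \<open>Distance monoids\<close>

text \<open>
  The operation \<open>\<oplus>\<close> and the element \<open>0\<close> of a distance monoid are the multiplication
  and the unit of an HOL-Algebra monoid; the total order is the one of the underlying type,
  restricted to the carrier.
\<close>

locale distance_monoid = comm_monoid R for R :: "'r::linorder monoid" (structure) +
  assumes le_add: "\<lbrakk>r \<in> carrier R; s \<in> carrier R\<rbrakk> \<Longrightarrow> r \<le> r \<otimes> s"
    and add_mono: "\<lbrakk>s \<in> carrier R; s' \<in> carrier R; t \<in> carrier R; s \<le> s'\<rbrakk>
                     \<Longrightarrow> s \<otimes> t \<le> s' \<otimes> t"

definition metrically_complete :: "'r::linorder monoid \<Rightarrow> bool" where
  "metrically_complete R \<longleftrightarrow>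
     (\<forall>r\<in>carrier R. \<forall>s\<in>carrier R. s \<le> r \<longrightarrow>
        (\<exists>t\<in>carrier R. r \<le> t \<otimes>\<^bsub>R\<^esub> s \<and>
           (\<forall>t'\<in>carrier R. r \<le> t' \<otimes>\<^bsub>R\<^esub> s \<longrightarrow> t \<le> t')))"

definition standard_monoid :: "'r::linorder monoid \<Rightarrow> bool" where
  "standard_monoid R \<longleftrightarrow>
     (\<forall>r\<in>carrier R. \<forall>s\<in>carrier R. r \<noteq> \<one>\<^bsub>R\<^esub> \<longrightarrow> s < r \<longrightarrow>
        (\<exists>t\<in>carrier R. t \<noteq> \<one>\<^bsub>R\<^esub> \<and> s \<otimes>\<^bsub>R\<^esub> t < r))"

definition nonneg_on :: "real set \<Rightarrow> real monoid" where
  "nonneg_on K = \<lparr>carrier = K \<inter> {0..}, mult = (+), one = 0\<rparr>"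

definition unit_interval_on :: "real set \<Rightarrow> real monoid" where
  "unit_interval_on K = \<lparr>carrier = K \<inter> {0..1}, mult = (\<lambda>r s. min (r + s) 1), one = 0\<rparr>"

abbreviation real_monoid :: "real monoid" where
  "real_monoid \<equiv> nonneg_on UNIV"

abbreviation rat_monoid :: "real monoid" where
  "rat_monoid \<equiv> nonneg_on \<rat>"

abbreviation real_unit_monoid :: "real monoid" where
  "real_unit_monoid \<equiv> unit_interval_on UNIV"

abbreviation rat_unit_monoid :: "real monoid" where
  "rat_unit_monoid \<equiv> unit_interval_on \<rat>"

lemma distance_monoid_nonneg_on:
  assumes "K = UNIV \<or> K = \<rat>"
  shows "distance_monoid (nonneg_on K)"
  using assms by unfold_locales (auto simp: nonneg_on_def)

lemma distance_monoid_unit_interval_on: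
  assumes "K = UNIV \<or> K = \<rat>"
  shows "distance_monoid (unit_interval_on K)"
  using assms by unfold_locales (auto simp: unit_interval_on_def min_def)


section \<open>Generalised metric spaces and Urysohn spaces\<close>

definition gen_metric_space ::
    "'r::linorder monoid \<Rightarrow> 'x set \<Rightarrow> ('x \<Rightarrow> 'x \<Rightarrow> 'r) \<Rightarrow> bool" where
  "gen_metric_space R X d \<longleftrightarrow>
     (\<forall>x\<in>X. \<forall>y\<in>X. d x y \<in> carrier R) \<and>
     (\<forall>x\<in>X. \<forall>y\<in>X. d x y = \<one>\<^bsub>R\<^esub> \<longleftrightarrow> x = y) \<and>
     (\<forall>x\<in>X. \<forall>y\<in>X. d x y = d y x) \<and>
     (\<forall>x\<in>X. \<forall>y\<in>X. \<forall>z\<in>X. d x z \<le> d x y \<otimes>\<^bsub>R\<^esub> d y z)"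

definition isometric_embedding ::
    "'x set \<Rightarrow> ('x \<Rightarrow> 'x \<Rightarrow> 'r) \<Rightarrow> 'y set \<Rightarrow> ('y \<Rightarrow> 'y \<Rightarrow> 'r) \<Rightarrow> ('x \<Rightarrow> 'y) \<Rightarrow> bool" where
  "isometric_embedding X d Y e f \<longleftrightarrow>
     f ` X \<subseteq> Y \<and> (\<forall>x\<in>X. \<forall>y\<in>X. e (f x) (f y) = d x y)"

definition isometry_between ::
    "'x set \<Rightarrow> ('x \<Rightarrow> 'x \<Rightarrow> 'r) \<Rightarrow> 'y set \<Rightarrow> ('y \<Rightarrow> 'y \<Rightarrow> 'r) \<Rightarrow> ('x \<Rightarrow> 'y) \<Rightarrow> bool" where
  "isometry_between X d Y e f \<longleftrightarrow> isometric_embedding X d Y e f \<and> f ` X = Y"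

text \<open>
  HOL cannot quantify over types inside a formula. Every finite space is isometric to one whose
  points are natural numbers, so universality is stated for the latter.
\<close>

definition urysohn_space ::
    "'r::linorder monoid \<Rightarrow> 'x set \<Rightarrow> ('x \<Rightarrow> 'x \<Rightarrow> 'r) \<Rightarrow> bool" where
  "urysohn_space R X d \<longleftrightarrow>
     gen_metric_space R X d \<and>
     (\<forall>(F :: nat set) e. finite F \<and> gen_metric_space R F e \<longrightarrow>
        (\<exists>f. isometric_embedding F e X d f)) \<and>
     (\<forall>A B f. finite A \<and> A \<subseteq> X \<and> finite B \<and> B \<subseteq> X \<and> isometry_between A d B d f \<longrightarrow>
        (\<exists>g. isometry_between X d X d g \<and> (\<forall>a\<in>A. g a = f a)))"

definition countable_urysohn_space ::
    "'r::linorder monoid \<Rightarrow> 'x set \<Rightarrow> ('x \<Rightarrow> 'x \<Rightarrow> 'r) \<Rightarrow> bool" where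
  "countable_urysohn_space R X d \<longleftrightarrow> countable X \<and> urysohn_space R X d"

text \<open>
  The spaces the theorem is about occupy a whole type. Here \<open>Q\<close> is identified
  with its image in the completion.
\<close>

definition completion_of :: "'u set \<Rightarrow> ('u \<Rightarrow> 'u \<Rightarrow> real) \<Rightarrow> bool" where
  "completion_of Q d \<longleftrightarrow>
     Metric_space UNIV d \<and> Metric_space.mcomplete UNIV d \<and>
     Metric_space.mtopology UNIV d closure_of Q = UNIV"

definition real_urysohn_space :: "('u \<Rightarrow> 'u \<Rightarrow> real) \<Rightarrow> bool" where
  "real_urysohn_space d \<longleftrightarrow>
     (\<exists>Q. countable_urysohn_space rat_monoid Q d \<and> completion_of Q d)"

definition real_urysohn_sphere :: "('u \<Rightarrow> 'u \<Rightarrow> real) \<Rightarrow> bool" where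
  "real_urysohn_sphere d \<longleftrightarrow>
     (\<exists>Q. countable_urysohn_space rat_unit_monoid Q d \<and> completion_of Q d)"


section \<open>Self-embeddings and the pointwise topologies\<close>

definition IE :: "('u \<Rightarrow> 'u \<Rightarrow> 'r) \<Rightarrow> ('u \<Rightarrow> 'u) monoid" where
  "IE d = \<lparr>carrier = {f. isometric_embedding UNIV d UNIV d f}, mult = (\<circ>), one = id\<rparr>"

lemma monoid_IE: "Group.monoid (IE d)"
  by unfold_locales (auto simp: IE_def isometric_embedding_def)

definition tau_pw :: "('u \<Rightarrow> 'u \<Rightarrow> 'r) \<Rightarrow> ('u \<Rightarrow> 'u) topology" where
  "tau_pw d =
     subtopology (product_topology (\<lambda>_. discrete_topology UNIV) UNIV) (carrier (IE d))"

definition gen_metric_topology ::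
    "'r::linorder monoid \<Rightarrow> ('u \<Rightarrow> 'u \<Rightarrow> 'r) \<Rightarrow> 'u topology" where
  "gen_metric_topology R d =
     topology_generated_by {{b. d a b < \<epsilon>} | a \<epsilon>. \<epsilon> \<in> carrier R \<and> \<epsilon> \<noteq> \<one>\<^bsub>R\<^esub>}"

definition tau_mpw ::
    "'r::linorder monoid \<Rightarrow> ('u \<Rightarrow> 'u \<Rightarrow> 'r) \<Rightarrow> ('u \<Rightarrow> 'u) topology" where
  "tau_mpw R d =
     subtopology (product_topology (\<lambda>_. gen_metric_topology R d) UNIV) (carrier (IE d))"


section \<open>Semigroup topologies and the Zariski topology\<close>

definition semigroup_topology :: "('a, 'b) monoid_scheme \<Rightarrow> 'a topology \<Rightarrow> bool" where
  "semigroup_topology G T \<longleftrightarrow>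
     topspace T = carrier G \<and>
     continuous_map (prod_topology T T) T (\<lambda>(x, y). x \<otimes>\<^bsub>G\<^esub> y)"

definition coarser_eq :: "'a topology \<Rightarrow> 'a topology \<Rightarrow> bool" where
  "coarser_eq S T \<longleftrightarrow> (\<forall>W. openin S W \<longrightarrow> openin T W)"

definition strictly_coarser :: "'a topology \<Rightarrow> 'a topology \<Rightarrow> bool" where
  "strictly_coarser S T \<longleftrightarrow> coarser_eq S T \<and> S \<noteq> T"

definition minimal_Hausdorff_semigroup_topology ::
    "('a, 'b) monoid_scheme \<Rightarrow> 'a topology \<Rightarrow> bool" where
  "minimal_Hausdorff_semigroup_topology G T \<longleftrightarrow>
     Hausdorff_space T \<and> semigroup_topology G T \<and>
     (\<forall>S. Hausdorff_space S \<and> semigroup_topology G S \<and> coarser_eq S T \<longrightarrow> S = T)"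

text \<open>
  \<open>zariski_word G [\<lambda>\<^sub>n, \<dots>, \<lambda>\<^sub>1] \<lambda>\<^sub>0 s\<close> is the product \<open>\<lambda>\<^sub>n s \<dots> \<lambda>\<^sub>1 s \<lambda>\<^sub>0\<close>.
\<close>

primrec zariski_word :: "('a, 'b) monoid_scheme \<Rightarrow> 'a list \<Rightarrow> 'a \<Rightarrow> 'a \<Rightarrow> 'a" where
  "zariski_word G [] l0 s = l0"
| "zariski_word G (l # ls) l0 s = l \<otimes>\<^bsub>G\<^esub> (s \<otimes>\<^bsub>G\<^esub> zariski_word G ls l0 s)"

text \<open>
  The solution sets form a subbasis. Inserting the carrier (the empty intersection) makes it the
  underlying set of the topology in every case, also when there are no solvable inequalities.
\<close>

definition zariski_topology :: "('a, 'b) monoid_scheme \<Rightarrow> 'a topology" where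
  "zariski_topology G = topology_generated_by (insert (carrier G)
     {{s \<in> carrier G. zariski_word G ls l0 s \<noteq> zariski_word G hs h0 s} | ls l0 hs h0.
        set ls \<subseteq> carrier G \<and> l0 \<in> carrier G \<and> set hs \<subseteq> carrier G \<and> h0 \<in> carrier G})"

end

theory Submission imports Defs begin

text \<open>
  Every Zariski-open set is open in every Hausdorff semigroup topology, so everything hinges on
  showing that \<open>{t. d (s x) (t x) < \<epsilon>}\<close> contains a Zariski neighbourhood of \<open>s\<close>. Choose embeddings
  \<open>\<mu>\<close>, \<open>\<nu>\<close> whose images are freely amalgamated over \<open>x\<close>, and \<open>\<alpha>\<close>, \<open>\<beta>\<close> that differ at \<open>s x\<close> but agree
  outside the \<open>\<delta>\<close>-ball around it. If \<open>\<alpha> t \<mu> \<noteq> \<beta> t \<mu>\<close> and \<open>\<alpha> t \<nu> \<noteq> \<beta> t \<nu>\<close>, then \<open>t\<close> maps some \<open>\<mu> u\<close> and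
  some \<open>\<nu> v\<close> into this ball; hence \<open>\<mu> u\<close> and \<open>\<nu> v\<close> are close to each other, by free amalgamation both
  are close to \<open>x\<close>, and so \<open>t x\<close> is close to \<open>s x\<close>.

  The embeddings exist in a countable Urysohn space because it contains every countable
  \<open>R\<close>-metric space. In the real cases they are constructed on the rational Urysohn space and
  extended to its completion, where approximate versions of their properties suffice.
\<close>

section \<open>Topologies from distances in a standard distance monoid\<close>

context distance_monoid begin

lemma one_le: "r \<in> carrier R \<Longrightarrow> \<one> \<le> r"
  using le_add[of \<one> r] by simp

lemma one_less_iff: "r \<in> carrier R \<Longrightarrow> \<one> < r \<longleftrightarrow> r \<noteq> \<one>"
  using one_le by (auto simp: less_le)

lemma le_add2: "r \<in> carrier R \<Longrightarrow> s \<in> carrier R \<Longrightarrow> r \<le> s \<otimes> r"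
  using le_add m_comm by metis

lemma add_mono2:
  assumes "r \<in> carrier R" "r' \<in> carrier R" "s \<in> carrier R" "s' \<in> carrier R" "r \<le> r'" "s \<le> s'"
  shows "r \<otimes> s \<le> r' \<otimes> s'"
proof -
  have "r \<otimes> s \<le> r' \<otimes> s" using assms add_mono by blast
  also have "\<dots> = s \<otimes> r'" using assms m_comm by blast
  also have "\<dots> \<le> s' \<otimes> r'" using assms add_mono by blast
  finally show ?thesis using assms m_comm by metis
qed

end

locale standard_distance_monoid = distance_monoid +
  assumes standard: "standard_monoid R"
    and nontrivial: "\<exists>r\<in>carrier R. r \<noteq> \<one>"
begin

lemma standardE:
  assumes "r \<in> carrier R" "s \<in> carrier R" "s < r"
  obtains t where "t \<in> carrier R" "t \<noteq> \<one>" "s \<otimes> t < r"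
proof -
  have "r \<noteq> \<one>" using assms one_le[of s] by auto
  then show ?thesis using standard assms that unfolding standard_monoid_def by blast
qed

lemma min_not_one:
  assumes "r \<in> carrier R" "s \<in> carrier R" "r \<noteq> \<one>" "s \<noteq> \<one>"
  shows "min r s \<in> carrier R" "min r s \<noteq> \<one>"
  using assms by (auto simp: min_def)

text \<open>Replaces division by two. Standardness at \<open>\<one> < r\<close> gives a nonzero
  \<open>s < r\<close>, standardness at \<open>s < r\<close> gives \<open>t\<close> with
  \<open>s \<otimes> t < r\<close>, and the minimum of the two can be added to itself.\<close>

lemma halve:
  assumes "r \<in> carrier R" "r \<noteq> \<one>"
  obtains t where "t \<in> carrier R" "t \<noteq> \<one>" "t \<otimes> t < r"
proof -
  obtain s where s: "s \<in> carrier R" "s \<noteq> \<one>" "\<one> \<otimes> s < r"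
    using standardE[of r \<one>] assms one_less_iff by auto
  then obtain t where t: "t \<in> carrier R" "t \<noteq> \<one>" "s \<otimes> t < r"
    using standardE[of r s] assms by auto
  have "min s t \<otimes> min s t \<le> s \<otimes> t"
    using s t min_not_one by (intro add_mono2) auto
  then show ?thesis using that[of "min s t"] s t min_not_one by fastforce
qed

lemma finite_radii_lower_bound:
  assumes "finite A" "\<And>a. a \<in> A \<Longrightarrow> e a \<in> carrier R \<and> e a \<noteq> \<one>"
  shows "\<exists>\<delta>\<in>carrier R. \<delta> \<noteq> \<one> \<and> (\<forall>a\<in>A. \<delta> \<le> e a)"
  using assms
proof (induction A)
  case empty
  then show ?case using nontrivial by auto
next
  case (insert a A)
  then obtain \<delta> where \<delta>: "\<delta> \<in> carrier R" "\<delta> \<noteq> \<one>" "\<forall>a\<in>A. \<delta> \<le> e a" by auto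
  have "e a \<in> carrier R" "e a \<noteq> \<one>" using insert by auto
  with \<delta> show ?case
    by (intro bexI[of _ "min \<delta> (e a)"]) (auto simp: min_not_one min_le_iff_disj)
qed

end

section \<open>The metric pointwise topology of a distance space\<close>

locale distance_space = standard_distance_monoid R
  for R :: "'r::linorder monoid" (structure) +
  fixes d :: "'u \<Rightarrow> 'u \<Rightarrow> 'r"
  assumes metric: "gen_metric_space R UNIV d"
begin

lemma dist_closed [simp, intro]: "d x y \<in> carrier R"
  and dist_eq_one [simp]: "d x y = \<one> \<longleftrightarrow> x = y"
  and dist_commute: "d x y = d y x"
  and triangle: "d x z \<le> d x y \<otimes> d y z"
  using metric unfolding gen_metric_space_def by auto

lemma dist_self: "d x x = \<one>"
  by simp

lemma dist_le_add:
  assumes "d x y \<le> r" "d y z \<le> s" "r \<in> carrier R" "s \<in> carrier R"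
  shows "d x z \<le> r \<otimes> s"
  using order_trans[OF triangle add_mono2[OF dist_closed assms(3) dist_closed assms(4,1,2)]] .

text \<open>For finite \<open>A\<close> these are the basic neighbourhoods of
  \<open>tau_mpw\<close>. One radius serves all of \<open>A\<close>, since finitely many nonzero
  radii have a nonzero lower bound.\<close>

definition near :: "('u \<Rightarrow> 'u) \<Rightarrow> 'u set \<Rightarrow> 'r \<Rightarrow> ('u \<Rightarrow> 'u) set" where
  "near s A \<epsilon> = {t \<in> carrier (IE d). \<forall>a\<in>A. d (s a) (t a) < \<epsilon>}"

lemma near_carrier: "t \<in> near s A \<epsilon> \<Longrightarrow> t \<in> carrier (IE d)"
  by (simp add: near_def)

lemma carrier_IE: "s \<in> carrier (IE d) \<longleftrightarrow> (\<forall>x y. d (s x) (s y) = d x y)"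
  by (auto simp: IE_def isometric_embedding_def)

lemma mult_IE [simp]: "s \<otimes>\<^bsub>IE d\<^esub> t = s \<circ> t"
  by (simp add: IE_def)

lemma openin_ball:
  assumes "\<epsilon> \<in> carrier R" "\<epsilon> \<noteq> \<one>"
  shows "openin (gen_metric_topology R d) {y. d x y < \<epsilon>}"
  unfolding gen_metric_topology_def using assms by (intro topology_generated_by_Basis) auto

text \<open>The generating balls have arbitrary centres and standardness recentres them: from
  \<open>d a x < \<epsilon>\<close> it yields a nonzero \<open>t\<close> with
  \<open>d a x \<otimes> t < \<epsilon>\<close>, so the \<open>t\<close>-ball around
  \<open>x\<close> fits inside.\<close>

lemma openin_gen_metric_topologyD:
  assumes "openin (gen_metric_topology R d) U" "x \<in> U"
  shows "\<exists>\<epsilon>\<in>carrier R. \<epsilon> \<noteq> \<one> \<and> {y. d x y < \<epsilon>} \<subseteq> U"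
proof -
  have "generate_topology_on {{b. d a b < \<epsilon>} | a \<epsilon>. \<epsilon> \<in> carrier R \<and> \<epsilon> \<noteq> \<one>} U"
    using assms(1) unfolding gen_metric_topology_def by (rule openin_topology_generated_by)
  then show ?thesis using assms(2)
  proof (induction arbitrary: x)
    case (Int U V)
    then obtain \<epsilon> \<delta> where "\<epsilon> \<in> carrier R" "\<epsilon> \<noteq> \<one>" "{y. d x y < \<epsilon>} \<subseteq> U"
      "\<delta> \<in> carrier R" "\<delta> \<noteq> \<one>" "{y. d x y < \<delta>} \<subseteq> V" by (meson IntD1 IntD2)
    then show ?case by (intro bexI[of _ "min \<epsilon> \<delta>"]) (auto simp: min_not_one)
  next
    case (UN K)
    then obtain k where k: "k \<in> K" "x \<in> k" by blast
    from UN.IH[OF k] k show ?case by blast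
  next
    case (Basis U)
    then obtain a \<epsilon> where U: "U = {b. d a b < \<epsilon>}" and \<epsilon>: "\<epsilon> \<in> carrier R" by blast
    then have "d a x < \<epsilon>" using Basis by blast
    then obtain t where t: "t \<in> carrier R" "t \<noteq> \<one>" "d a x \<otimes> t < \<epsilon>"
      using standardE[OF \<epsilon> dist_closed] by blast
    have "{y. d x y < t} \<subseteq> U"
      using U t dist_le_add[of a x "d a x" _ t] by (fastforce dest: less_imp_le)
    with t show ?case by blast
  qed simp
qed

lemma topspace_gen_metric_topology [simp]: "topspace (gen_metric_topology R d) = UNIV"
proof -
  \<comment> \<open>A nonzero radius makes balls exist at all; every \<open>x\<close> lies in the
    \<open>r\<close>-ball around itself, so the generating sets cover the type.\<close>
  obtain r where r: "r \<in> carrier R" "r \<noteq> \<one>" using nontrivial by blast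
  have "x \<in> topspace (gen_metric_topology R d)" for x
    using openin_subset[OF openin_ball[OF r, of x]] r one_less_iff[of r] dist_eq_one[of x x]
    by (auto simp del: dist_eq_one)
  then show ?thesis by blast
qed

lemma topspace_tau_mpw [simp]: "topspace (tau_mpw R d) = carrier (IE d)"
  by (auto simp: tau_mpw_def)

lemma openin_near:
  assumes "finite A" "\<epsilon> \<in> carrier R" "\<epsilon> \<noteq> \<one>"
  shows "openin (tau_mpw R d) (near s A \<epsilon>)"
proof -
  let ?U = "\<lambda>x. if x \<in> A then {y. d (s x) y < \<epsilon>} else UNIV"
  have "{x. ?U x \<noteq> UNIV} \<subseteq> A" by auto
  then have "finite {x. ?U x \<noteq> UNIV}" using assms finite_subset by blast
  then have "openin (product_topology (\<lambda>_. gen_metric_topology R d) UNIV) (Pi\<^sub>E UNIV ?U)"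
    using openin_ball[OF assms(2,3)] openin_topspace[of "gen_metric_topology R d"]
    by (subst openin_PiE_gen) auto
  moreover have "near s A \<epsilon> = Pi\<^sub>E UNIV ?U \<inter> carrier (IE d)"
    by (auto simp: near_def PiE_iff split: if_splits)
  ultimately show ?thesis unfolding tau_mpw_def openin_subtopology by blast
qed

lemma near_self: "s \<in> carrier (IE d) \<Longrightarrow> \<epsilon> \<in> carrier R \<Longrightarrow> \<epsilon> \<noteq> \<one> \<Longrightarrow> s \<in> near s A \<epsilon>"
  using one_less_iff[of \<epsilon>] by (simp add: near_def dist_self)

lemma openin_tau_mpwD:
  assumes "openin (tau_mpw R d) W" "s \<in> W"
  obtains A \<epsilon> where "finite A" "\<epsilon> \<in> carrier R" "\<epsilon> \<noteq> \<one>" "near s A \<epsilon> \<subseteq> W"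
proof -
  obtain V where V: "openin (product_topology (\<lambda>_. gen_metric_topology R d) UNIV) V"
      "W = V \<inter> carrier (IE d)"
    using assms(1) unfolding tau_mpw_def openin_subtopology by blast
  then obtain U where U: "finite {x. U x \<noteq> UNIV}" "\<And>x. openin (gen_metric_topology R d) (U x)"
      "s \<in> Pi\<^sub>E UNIV U" "Pi\<^sub>E UNIV U \<subseteq> V"
    using assms(2) by (auto simp: openin_product_topology_alt)
  \<comment> \<open>Only finitely many coordinates of the box given by \<open>U\<close> are
    constrained, and a lower bound of their radii keeps a neighbourhood of \<open>s\<close> inside
    the box.\<close>
  define A where "A = {x. U x \<noteq> UNIV}"
  have "\<exists>\<epsilon>\<in>carrier R. \<epsilon> \<noteq> \<one> \<and> {y. d (s x) y < \<epsilon>} \<subseteq> U x" for x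
    using U by (intro openin_gen_metric_topologyD) (auto simp: PiE_iff)
  then obtain e where e: "\<And>x. e x \<in> carrier R" "\<And>x. e x \<noteq> \<one>" "\<And>x. {y. d (s x) y < e x} \<subseteq> U x"
    by metis
  obtain \<delta> where \<delta>: "\<delta> \<in> carrier R" "\<delta> \<noteq> \<one>" "\<forall>a\<in>A. \<delta> \<le> e a"
    using finite_radii_lower_bound[of A e] U e unfolding A_def by blast
  have "near s A \<delta> \<subseteq> W"
  proof
    fix t assume t: "t \<in> near s A \<delta>"
    have "t x \<in> U x" for x
    proof (cases "x \<in> A")
      case True
      then have "d (s x) (t x) < e x" using t \<delta> unfolding near_def by fastforce
      then show ?thesis using e by blast
    qed (auto simp: A_def)
    then have "t \<in> V" using U by (auto simp: PiE_iff)
    then show "t \<in> W" using V t unfolding near_def by blast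
  qed
  then show ?thesis using that[of A \<delta>] U \<delta> unfolding A_def by blast
qed

lemma Hausdorff_tau_mpw: "Hausdorff_space (tau_mpw R d)"
  unfolding Hausdorff_space_def
proof (intro allI impI, elim conjE)
  fix s t assume st: "s \<in> topspace (tau_mpw R d)" "t \<in> topspace (tau_mpw R d)" "s \<noteq> t"
  then obtain x where x: "s x \<noteq> t x" by (auto simp: fun_eq_iff)
  obtain \<delta> where \<delta>: "\<delta> \<in> carrier R" "\<delta> \<noteq> \<one>" "\<delta> \<otimes> \<delta> < d (s x) (t x)"
    using halve[of "d (s x) (t x)"] x by auto
  have "False" if r: "r \<in> near s {x} \<delta>" "r \<in> near t {x} \<delta>" for r
  proof -
    have "d (s x) (r x) \<le> \<delta>" "d (r x) (t x) \<le> \<delta>"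
      using r dist_commute[of "r x" "t x"] by (auto simp: near_def)
    then have "d (s x) (t x) \<le> \<delta> \<otimes> \<delta>" using \<delta> by (intro dist_le_add)
    then show False using \<delta> by order
  qed
  then have "disjnt (near s {x} \<delta>) (near t {x} \<delta>)" unfolding disjnt_iff by blast
  moreover have "s \<in> near s {x} \<delta>" "t \<in> near t {x} \<delta>" using near_self st \<delta> by simp_all
  ultimately show "\<exists>U V. openin (tau_mpw R d) U \<and> openin (tau_mpw R d) V \<and> s \<in> U \<and> t \<in> V \<and> disjnt U V"
    using openin_near[of "{x}" \<delta>] \<delta> by blast
qed

text \<open>Composition is jointly continuous because the maps are isometries: replacing
  \<open>t a\<close> by \<open>t' a\<close> moves the value of \<open>s'\<close> by exactly
  \<open>d (t a) (t' a)\<close>. So \<open>s\<close> has to be controlled on the image of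
  \<open>A\<close> under \<open>t\<close>, and \<open>t\<close> on \<open>A\<close>.\<close>

lemma semigroup_topology_tau_mpw: "semigroup_topology (IE d) (tau_mpw R d)"
  unfolding semigroup_topology_def
proof
  let ?m = "\<lambda>(x, y). x \<otimes>\<^bsub>IE d\<^esub> y"
  show "continuous_map (prod_topology (tau_mpw R d) (tau_mpw R d)) (tau_mpw R d) ?m"
    unfolding continuous_map_def
  proof (intro conjI allI impI)
    show "?m \<in> topspace (prod_topology (tau_mpw R d) (tau_mpw R d)) \<rightarrow> topspace (tau_mpw R d)"
      by (auto simp: carrier_IE)
    fix W assume W: "openin (tau_mpw R d) W"
    show "openin (prod_topology (tau_mpw R d) (tau_mpw R d))
       {x \<in> topspace (prod_topology (tau_mpw R d) (tau_mpw R d)). ?m x \<in> W}"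
      unfolding openin_prod_topology_alt
    proof (intro allI impI)
      fix s t assume "(s, t) \<in> {x \<in> topspace (prod_topology (tau_mpw R d) (tau_mpw R d)). ?m x \<in> W}"
      then have st: "s \<in> carrier (IE d)" "t \<in> carrier (IE d)" "s \<circ> t \<in> W" by auto
      obtain A \<epsilon> where A: "finite A" "\<epsilon> \<in> carrier R" "\<epsilon> \<noteq> \<one>" "near (s \<circ> t) A \<epsilon> \<subseteq> W"
        using openin_tau_mpwD[OF W st(3)] by blast
      obtain \<delta> where \<delta>: "\<delta> \<in> carrier R" "\<delta> \<noteq> \<one>" "\<delta> \<otimes> \<delta> < \<epsilon>" using halve A by blast
      have "s' \<circ> t' \<in> W" if "s' \<in> near s (t ` A) \<delta>" "t' \<in> near t A \<delta>" for s' t'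
      proof -
        have "d (s (t a)) (s' (t' a)) < \<epsilon>" if "a \<in> A" for a
        proof -
          have "d (s (t a)) (s' (t a)) \<le> \<delta>" "d (s' (t a)) (s' (t' a)) \<le> \<delta>"
            using \<open>s' \<in> _\<close> \<open>t' \<in> _\<close> that by (auto simp: near_def carrier_IE)
          then have "d (s (t a)) (s' (t' a)) \<le> \<delta> \<otimes> \<delta>" using \<delta> dist_le_add by blast
          then show ?thesis using \<delta> by order
        qed
        then have "s' \<circ> t' \<in> near (s \<circ> t) A \<epsilon>" using that by (auto simp: near_def carrier_IE)
        then show ?thesis using A by blast
      qed
      then have "near s (t ` A) \<delta> \<times> near t A \<delta> \<subseteq> {x \<in> topspace (prod_topology (tau_mpw R d) (tau_mpw R d)). ?m x \<in> W}"
        by (auto dest: near_carrier)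
      moreover have "openin (tau_mpw R d) (near s (t ` A) \<delta>)" "openin (tau_mpw R d) (near t A \<delta>)"
        "s \<in> near s (t ` A) \<delta>" "t \<in> near t A \<delta>"
        using A(1) \<delta> st by (simp_all add: openin_near near_self)
      ultimately show "\<exists>U V. openin (tau_mpw R d) U \<and> openin (tau_mpw R d) V \<and> s \<in> U \<and> t \<in> V \<and>
           U \<times> V \<subseteq> {x \<in> topspace (prod_topology (tau_mpw R d) (tau_mpw R d)). ?m x \<in> W}"
        by blast
    qed
  qed
qed simp

lemma tau_mpw_coarser_tau_pw: "coarser_eq (tau_mpw R d) (tau_pw d)"
  unfolding coarser_eq_def
proof (intro allI impI)
  let ?P = "product_topology (\<lambda>_::'u. discrete_topology (UNIV::'u set)) UNIV"
  fix W assume "openin (tau_mpw R d) W"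
  then obtain V where V: "openin (product_topology (\<lambda>_. gen_metric_topology R d) UNIV) V"
      "W = V \<inter> carrier (IE d)"
    unfolding tau_mpw_def openin_subtopology by blast
  from V(1) have "openin ?P V" by (simp add: openin_product_topology_alt) blast
  then show "openin (tau_pw d) W" using V(2) unfolding tau_pw_def openin_subtopology by blast
qed

lemma openin_tau_pw_eval: "openin (tau_pw d) {s \<in> carrier (IE d). s x = y}"
proof -
  let ?P = "product_topology (\<lambda>_::'u. discrete_topology (UNIV::'u set)) UNIV"
  have "openin ?P {s \<in> topspace ?P. s x \<in> {y}}"
    by (rule openin_continuous_map_preimage[OF continuous_map_product_projection]) auto
  moreover have "{s \<in> carrier (IE d). s x = y} = {s \<in> topspace ?P. s x \<in> {y}} \<inter> carrier (IE d)"
    by auto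
  ultimately show ?thesis unfolding tau_pw_def openin_subtopology by blast
qed

end

section \<open>The Zariski topology\<close>

lemma topspace_zariski_topology [simp]: "topspace (zariski_topology G) = carrier G"
  by (auto simp: zariski_topology_def)

lemma openin_zariski_inequation:
  assumes "set ls \<subseteq> carrier G" "l0 \<in> carrier G" "set hs \<subseteq> carrier G" "h0 \<in> carrier G"
  shows "openin (zariski_topology G) {s \<in> carrier G. zariski_word G ls l0 s \<noteq> zariski_word G hs h0 s}"
  unfolding zariski_topology_def using assms by (intro topology_generated_by_Basis) blast

lemma continuous_map_zariski_word:
  assumes "semigroup_topology G T" "set ls \<subseteq> carrier G" "l0 \<in> carrier G"
  shows "continuous_map T T (\<lambda>s. zariski_word G ls l0 s)"
proof -
  have m: "continuous_map T T (\<lambda>s. f s \<otimes>\<^bsub>G\<^esub> g s)"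
    if "continuous_map T T f" "continuous_map T T g" for f g
    using continuous_map_compose[OF continuous_map_pairedI[OF that], of T "\<lambda>(x, y). x \<otimes>\<^bsub>G\<^esub> y"] assms(1)
    by (simp add: semigroup_topology_def o_def)
  show ?thesis
    using assms(2)
  proof (induction ls)
    case Nil
    then show ?case using assms by (simp add: semigroup_topology_def)
  next
    case (Cons l ls)
    have "continuous_map T T (\<lambda>s. l)" using Cons.prems assms by (simp add: semigroup_topology_def)
    moreover have "continuous_map T T (\<lambda>s. s \<otimes>\<^bsub>G\<^esub> zariski_word G ls l0 s)"
      using Cons by (intro m) simp_all
    ultimately show ?case using m by simp
  qed
qed

text \<open>Both sides of an inequation are continuous in \<open>s\<close>, and continuous maps into
  a Hausdorff space agree on a closed set, so every subbasic set is open in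
  \<open>T\<close>.\<close>

lemma zariski_topology_coarser:
  assumes "Hausdorff_space T" "semigroup_topology G T"
  shows "coarser_eq (zariski_topology G) T"
  unfolding coarser_eq_def
proof (intro allI impI)
  have top: "topspace T = carrier G" using assms(2) by (simp add: semigroup_topology_def)
  let ?S = "insert (carrier G)
     {{s \<in> carrier G. zariski_word G ls l0 s \<noteq> zariski_word G hs h0 s} | ls l0 hs h0.
        set ls \<subseteq> carrier G \<and> l0 \<in> carrier G \<and> set hs \<subseteq> carrier G \<and> h0 \<in> carrier G}"
  fix W assume "openin (zariski_topology G) W"
  then have "generate_topology_on ?S W"
    unfolding zariski_topology_def by (rule openin_topology_generated_by)
  then show "openin T W"
  proof induction
    case (Basis W)
    then consider "W = carrier G" | ls l0 hs h0 where
        "W = {s \<in> carrier G. zariski_word G ls l0 s \<noteq> zariski_word G hs h0 s}"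
        "set ls \<subseteq> carrier G" "l0 \<in> carrier G" "set hs \<subseteq> carrier G" "h0 \<in> carrier G"
      by blast
    then show ?case
    proof cases
      case 1
      then show ?thesis using top by (metis openin_topspace)
    next
      case 2
      have "closedin T {s \<in> topspace T. zariski_word G ls l0 s = zariski_word G hs h0 s}"
        by (rule closedin_continuous_maps_eq[OF assms(1) continuous_map_zariski_word[OF assms(2)]
              continuous_map_zariski_word[OF assms(2)]]) (use 2 in auto)
      moreover have "W = topspace T - {s \<in> topspace T. zariski_word G ls l0 s = zariski_word G hs h0 s}"
        using 2 top by auto
      ultimately show ?thesis by blast
    qed
  qed auto
qed

text \<open>A Hausdorff semigroup topology coarser than \<open>T\<close> is finer than the Zariski
  topology, so it is squeezed between two equal topologies.\<close>

lemma minimal_if_eq_zariski_topology: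
  assumes "Hausdorff_space T" "semigroup_topology G T" "zariski_topology G = T"
  shows "minimal_Hausdorff_semigroup_topology G T"
  using assms zariski_topology_coarser
  unfolding minimal_Hausdorff_semigroup_topology_def coarser_eq_def
  by (metis topology_eq)

section \<open>Criteria for comparing the three topologies\<close>

context distance_space begin

text \<open>\<open>fans\<close> and \<open>splits\<close> are the only geometric input. The common
  point of a fan may lie anywhere within \<open>\<epsilon>\<close> of \<open>x\<close>, so that in a
  completion it can be chosen in the dense countable subspace.\<close>

lemma zariski_eq_tau_mpw:
  assumes fans: "\<And>x \<epsilon>. \<epsilon> \<in> carrier R \<Longrightarrow> \<epsilon> \<noteq> \<one> \<Longrightarrow>
      \<exists>\<mu>\<in>carrier (IE d). \<exists>\<nu>\<in>carrier (IE d). \<exists>p q. \<mu> p = \<nu> q \<and> d x (\<mu> p) < \<epsilon> \<and>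
        (\<forall>u v. d (\<mu> u) (\<mu> p) \<le> d (\<mu> u) (\<nu> v))"
    and splits: "\<And>a \<epsilon>. \<epsilon> \<in> carrier R \<Longrightarrow> \<epsilon> \<noteq> \<one> \<Longrightarrow>
      \<exists>\<alpha>\<in>carrier (IE d). \<exists>\<beta>\<in>carrier (IE d). \<alpha> a \<noteq> \<beta> a \<and> (\<forall>z. \<epsilon> \<le> d a z \<longrightarrow> \<alpha> z = \<beta> z)"
  shows "zariski_topology (IE d) = tau_mpw R d"
proof -
  let ?Z = "zariski_topology (IE d)"
  have point: "\<exists>V. openin ?Z V \<and> s \<in> V \<and> V \<subseteq> near s {x} \<epsilon>"
    if s: "s \<in> carrier (IE d)" and \<epsilon>: "\<epsilon> \<in> carrier R" "\<epsilon> \<noteq> \<one>" for s x \<epsilon>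
  proof -
    \<comment> \<open>Four halvings pay for four triangle inequalities: two \<open>\<delta>\<close>
      stay below \<open>e2\<close>, two \<open>e2\<close> below \<open>e1\<close>, two
      \<open>e1\<close> below \<open>e\<close>, and two \<open>e\<close> below
      \<open>\<epsilon>\<close>.\<close>
    obtain e where e: "e \<in> carrier R" "e \<noteq> \<one>" "e \<otimes> e < \<epsilon>" using halve \<epsilon> by blast
    obtain e1 where e1: "e1 \<in> carrier R" "e1 \<noteq> \<one>" "e1 \<otimes> e1 < e" using halve e by blast
    obtain e2 where e2: "e2 \<in> carrier R" "e2 \<noteq> \<one>" "e2 \<otimes> e2 < e1" using halve e1 by blast
    obtain \<delta> where \<delta>: "\<delta> \<in> carrier R" "\<delta> \<noteq> \<one>" "\<delta> \<otimes> \<delta> < e2" using halve e2 by blast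
    have le: "\<delta> \<le> e2" "e2 \<le> e1" "e1 \<le> e"
      using le_add[OF \<delta>(1) \<delta>(1)] le_add[OF e2(1) e2(1)] le_add[OF e1(1) e1(1)] \<delta>(3) e2(3) e1(3)
      by simp_all
    obtain \<mu> \<nu> p q where fan: "\<mu> \<in> carrier (IE d)" "\<nu> \<in> carrier (IE d)" "\<mu> p = \<nu> q"
      "d x (\<mu> p) < \<delta>" "\<And>u v. d (\<mu> u) (\<mu> p) \<le> d (\<mu> u) (\<nu> v)"
      using fans[OF \<delta>(1,2), of x] by blast
    define y where "y = \<mu> p"
    \<comment> \<open>The split is placed at \<open>s y\<close> rather than \<open>s x\<close>,
      because the two copies meet at \<open>y\<close>, which is merely close to
      \<open>x\<close>.\<close>
    obtain \<alpha> \<beta> where split: "\<alpha> \<in> carrier (IE d)" "\<beta> \<in> carrier (IE d)" "\<alpha> (s y) \<noteq> \<beta> (s y)"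
      "\<And>z. \<delta> \<le> d (s y) z \<Longrightarrow> \<alpha> z = \<beta> z"
      using splits[OF \<delta>(1,2), of "s y"] by blast
    define V where "V \<rho> = {t \<in> carrier (IE d). zariski_word (IE d) [\<alpha>] \<rho> t \<noteq> zariski_word (IE d) [\<beta>] \<rho> t}" for \<rho>
    have V: "openin ?Z (V \<mu> \<inter> V \<nu>)"
      unfolding V_def using fan split by (intro openin_Int openin_zariski_inequation) auto
    have sV: "s \<in> V \<mu> \<inter> V \<nu>"
    proof -
      \<comment> \<open>The points \<open>p\<close> and \<open>q\<close> witness the inequations for
        \<open>s\<close>: \<open>\<mu> p\<close> and \<open>\<nu> q\<close> both equal
        \<open>y\<close>, and \<open>\<alpha>\<close>, \<open>\<beta>\<close> differ at
        \<open>s y\<close>.\<close>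
      have "(\<alpha> \<circ> (s \<circ> \<mu>)) p \<noteq> (\<beta> \<circ> (s \<circ> \<mu>)) p" "(\<alpha> \<circ> (s \<circ> \<nu>)) q \<noteq> (\<beta> \<circ> (s \<circ> \<nu>)) q"
        using split(3) fan(3) by (simp_all add: y_def)
      then have "\<alpha> \<circ> (s \<circ> \<mu>) \<noteq> \<beta> \<circ> (s \<circ> \<mu>)" "\<alpha> \<circ> (s \<circ> \<nu>) \<noteq> \<beta> \<circ> (s \<circ> \<nu>)" by metis+
      then show ?thesis using s by (simp add: V_def)
    qed
    have hit: "\<exists>u. d (s y) (t (\<rho> u)) \<le> \<delta>" if "t \<in> V \<rho>" for t \<rho>
    proof -
      have "\<alpha> \<circ> (t \<circ> \<rho>) \<noteq> \<beta> \<circ> (t \<circ> \<rho>)" using that by (simp add: V_def)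
      then obtain u where "\<alpha> (t (\<rho> u)) \<noteq> \<beta> (t (\<rho> u))" by (auto simp: fun_eq_iff)
      then show ?thesis using split(4) by (meson le_cases)
    qed
    have "t \<in> near s {x} \<epsilon>" if t: "t \<in> V \<mu> \<inter> V \<nu>" for t
    proof -
      have tC: "d (t u) (t v) = d u v" for u v using t by (simp add: V_def carrier_IE)
      have sC: "d (s u) (s v) = d u v" for u v using s by (simp add: carrier_IE)
      obtain u v where u: "d (s y) (t (\<mu> u)) \<le> \<delta>" and v: "d (s y) (t (\<nu> v)) \<le> \<delta>"
        using hit t by blast
      have "d (t (\<mu> u)) (t (\<nu> v)) \<le> \<delta> \<otimes> \<delta>" 
        using u v \<delta> dist_commute by (intro dist_le_add[where y = "s y"]) auto
      then have "d (\<mu> u) y \<le> e2" 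
        using fan(5)[of u v] \<delta>(3) unfolding tC y_def by order
      then have "d (s y) (t y) \<le> e2 \<otimes> e2"
        using u le e2 by (intro dist_le_add[where y = "t (\<mu> u)"]) (auto simp: tC)
      moreover have xy: "d x y \<le> e1" using fan(4) le unfolding y_def by order
      ultimately have "d (s x) (t y) \<le> e1 \<otimes> e1"
        using e1 e2 by (intro dist_le_add[where y = "s y"]) (auto simp: sC)
      then have "d (s x) (t x) \<le> e \<otimes> e"
        using e e1 xy le dist_commute[of x y] by (intro dist_le_add[where y = "t y"]) (auto simp: tC)
      then have "d (s x) (t x) < \<epsilon>" using e by order
      then show ?thesis using t by (simp add: near_def V_def)
    qed
    then show ?thesis using V sV by blast
  qed
  have "openin ?Z W" if W: "openin (tau_mpw R d) W" for W
  proof (subst openin_subopen, intro ballI)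
    fix s assume sW: "s \<in> W"
    then have s: "s \<in> carrier (IE d)" using openin_subset[OF W] by auto
    obtain A \<epsilon> where A: "finite A" "\<epsilon> \<in> carrier R" "\<epsilon> \<noteq> \<one>" "near s A \<epsilon> \<subseteq> W"
      using openin_tau_mpwD[OF W sW] by blast
    obtain V where V: "\<And>x. openin ?Z (V x)" "\<And>x. s \<in> V x" "\<And>x. V x \<subseteq> near s {x} \<epsilon>"
      using point[OF s A(2,3)] by metis
    \<comment> \<open>Intersecting with the whole space covers the case of empty
      \<open>A\<close>.\<close>
    have "openin ?Z ((\<Inter>x\<in>A. V x) \<inter> topspace ?Z)" using A V by (intro openin_INT)
    moreover have "(\<Inter>x\<in>A. V x) \<inter> topspace ?Z \<subseteq> near s A \<epsilon>"
      using V(3) by (auto simp: near_def)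
    ultimately show "\<exists>T. openin ?Z T \<and> s \<in> T \<and> T \<subseteq> W" using V(2) s A(4)
      by (intro exI[of _ "(\<Inter>x\<in>A. V x) \<inter> topspace ?Z"]) auto
  qed
  then show ?thesis
    using zariski_topology_coarser[OF Hausdorff_tau_mpw semigroup_topology_tau_mpw]
    unfolding coarser_eq_def topology_eq by blast
qed

text \<open>Since \<open>\<beta>\<close> moves every value of \<open>\<alpha>\<close> by less than
  \<open>\<epsilon>\<close>, it lies in each \<open>\<epsilon>\<close>-neighbourhood of
  \<open>\<alpha>\<close>, whatever the finite set \<open>A\<close>, yet it agrees with
  \<open>\<alpha>\<close> nowhere. Prescribing the value at one point is therefore not a
  \<open>tau_mpw\<close>-open condition.\<close>

lemma tau_mpw_neq_tau_pw:
  assumes "\<alpha> \<in> carrier (IE d)"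
    and "\<And>\<epsilon>. \<epsilon> \<in> carrier R \<Longrightarrow> \<epsilon> \<noteq> \<one> \<Longrightarrow>
      \<exists>\<beta>\<in>carrier (IE d). \<forall>u. \<beta> u \<noteq> \<alpha> u \<and> d (\<alpha> u) (\<beta> u) < \<epsilon>"
  shows "tau_mpw R d \<noteq> tau_pw d"
proof
  fix x :: 'u
  assume "tau_mpw R d = tau_pw d"
  then have op: "openin (tau_mpw R d) {s \<in> carrier (IE d). s x = \<alpha> x}" using openin_tau_pw_eval by simp
  obtain A \<epsilon> where "finite A" and \<epsilon>: "\<epsilon> \<in> carrier R" "\<epsilon> \<noteq> \<one>"
    and A: "near \<alpha> A \<epsilon> \<subseteq> {s \<in> carrier (IE d). s x = \<alpha> x}"
    by (rule openin_tau_mpwD[OF op, of \<alpha>]) (use assms(1) in simp)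
  obtain \<beta> where \<beta>: "\<beta> \<in> carrier (IE d)" "\<And>u. \<beta> u \<noteq> \<alpha> u" "\<And>u. d (\<alpha> u) (\<beta> u) < \<epsilon>"
    using assms(2)[OF \<epsilon>] by auto
  then have "\<beta> \<in> near \<alpha> A \<epsilon>" by (simp add: near_def)
  then have "\<beta> x = \<alpha> x" using A by auto
  then show False using \<beta>(2) by simp
qed

end

section \<open>Universality for countable spaces\<close>

text \<open>Distinct points may have distance zero. An amalgam can thus be a formula on a disjoint
  union of copies, where points are glued by giving them distance zero.\<close>

definition gen_pseudometric_space :: "'r::linorder monoid \<Rightarrow> 'x set \<Rightarrow> ('x \<Rightarrow> 'x \<Rightarrow> 'r) \<Rightarrow> bool" where
  "gen_pseudometric_space R X d \<longleftrightarrow>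
     (\<forall>x\<in>X. \<forall>y\<in>X. d x y \<in> carrier R) \<and>
     (\<forall>x\<in>X. d x x = \<one>\<^bsub>R\<^esub>) \<and>
     (\<forall>x\<in>X. \<forall>y\<in>X. d x y = d y x) \<and>
     (\<forall>x\<in>X. \<forall>y\<in>X. \<forall>z\<in>X. d x z \<le> d x y \<otimes>\<^bsub>R\<^esub> d y z)"

lemma gen_metric_space_subset:
  "gen_metric_space R X d \<Longrightarrow> Y \<subseteq> X \<Longrightarrow> gen_metric_space R Y d"
  by (simp add: gen_metric_space_def subset_iff)

locale countable_urysohn = distance_monoid R
  for R :: "'r::linorder monoid" (structure) +
  fixes Q :: "'u set" and d :: "'u \<Rightarrow> 'u \<Rightarrow> 'r"
  assumes urysohn: "countable_urysohn_space R Q d"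
begin

lemmas urysohn_conjuncts = urysohn[unfolded countable_urysohn_space_def urysohn_space_def]

lemma countable_Q: "countable Q"
  and metric: "gen_metric_space R Q d"
  by (rule urysohn_conjuncts[THEN conjunct1] urysohn_conjuncts[THEN conjunct2, THEN conjunct1])+

lemma universal: "finite (F :: nat set) \<Longrightarrow> gen_metric_space R F e \<Longrightarrow> \<exists>f. isometric_embedding F e Q d f"
  by (rule urysohn_conjuncts[THEN conjunct2, THEN conjunct2, THEN conjunct1, rule_format]) simp

lemma homogeneous:
  assumes "finite A" "A \<subseteq> Q" "finite B" "B \<subseteq> Q" "isometry_between A d B d f"
  shows "\<exists>g. isometry_between Q d Q d g \<and> (\<forall>a\<in>A. g a = f a)"
  by (rule urysohn_conjuncts[THEN conjunct2, THEN conjunct2, THEN conjunct2, THEN spec[of _ A],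
      THEN spec[of _ B], THEN spec[of _ f], THEN mp]) (intro conjI assms)

lemmas metric_conjuncts = metric[unfolded gen_metric_space_def]

lemma dist_closed: "x \<in> Q \<Longrightarrow> y \<in> Q \<Longrightarrow> d x y \<in> carrier R"
  by (rule metric_conjuncts[THEN conjunct1, rule_format])

lemma dist_eq_one: "x \<in> Q \<Longrightarrow> y \<in> Q \<Longrightarrow> d x y = \<one> \<longleftrightarrow> x = y"
  by (rule metric_conjuncts[THEN conjunct2, THEN conjunct1, rule_format])

lemma dist_commute: "x \<in> Q \<Longrightarrow> y \<in> Q \<Longrightarrow> d x y = d y x"
  by (rule metric_conjuncts[THEN conjunct2, THEN conjunct2, THEN conjunct1, rule_format])

lemma triangle: "x \<in> Q \<Longrightarrow> y \<in> Q \<Longrightarrow> z \<in> Q \<Longrightarrow> d x z \<le> d x y \<otimes> d y z"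
  by (rule metric_conjuncts[THEN conjunct2, THEN conjunct2, THEN conjunct2, rule_format])

text \<open>Universality gives an unrelated copy \<open>g\<close> of the enlarged space. Homogeneity
  extends the finite isometry carrying \<open>g\<close> to \<open>f\<close> on \<open>F\<close> to a
  global isometry \<open>h\<close>, and \<open>h \<circ> g\<close> extends \<open>f\<close>.\<close>

lemma extend_embedding:
  fixes F :: "nat set"
  assumes fin: "finite F" and e: "gen_metric_space R (insert n F) e" and f: "isometric_embedding F e Q d f"
  shows "\<exists>f'. isometric_embedding (insert n F) e Q d f' \<and> (\<forall>x\<in>F. f' x = f x)"
proof -
  obtain g where g: "isometric_embedding (insert n F) e Q d g"
    using universal[OF _ e] fin by blast
  then have gQ: "g ` insert n F \<subseteq> Q" and gd: "\<And>x y. x \<in> insert n F \<Longrightarrow> y \<in> insert n F \<Longrightarrow> d (g x) (g y) = e x y"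
    unfolding isometric_embedding_def by blast+
  have inj: "inj_on g F"
  proof
    fix x y assume "x \<in> F" "y \<in> F" "g x = g y"
    then have "e x y = \<one>" using gd[of x y] dist_eq_one[of "g x" "g y"] gQ by auto
    then show "x = y" using e \<open>x \<in> F\<close> \<open>y \<in> F\<close> unfolding gen_metric_space_def by blast
  qed
  have "isometry_between (g ` F) d (f ` F) d (f \<circ> inv_into F g)"
    using inj f gd unfolding isometry_between_def isometric_embedding_def
    by (auto simp: image_image)
  moreover have "f ` F \<subseteq> Q" using f unfolding isometric_embedding_def by blast
  moreover have "g ` F \<subseteq> Q" "finite (g ` F)" "finite (f ` F)" using gQ fin by auto
  ultimately obtain h where h: "isometry_between Q d Q d h" "\<forall>a\<in>g ` F. h a = (f \<circ> inv_into F g) a"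
    using homogeneous[of "g ` F" "f ` F" "f \<circ> inv_into F g"] by blast
  have hQ: "h x \<in> Q" "d (h x) (h y) = d x y" if "x \<in> Q" "y \<in> Q" for x y
    using h(1) that unfolding isometry_between_def isometric_embedding_def by blast+
  have gQ': "g x \<in> Q" if "x \<in> insert n F" for x using gQ that by blast
  have "isometric_embedding (insert n F) e Q d (h \<circ> g)"
    unfolding isometric_embedding_def image_subset_iff comp_apply
    using hQ[OF gQ' gQ'] gd by metis
  moreover have "\<forall>x\<in>F. (h \<circ> g) x = f x" using h(2) inj by simp
  ultimately show ?thesis by blast
qed

text \<open>One-point extensions are iterated along the initial segments of \<open>S\<close>, and
  the embeddings of the segments are glued.\<close>

lemma universal_nat:
  fixes S :: "nat set"
  assumes e: "gen_metric_space R S e"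
  shows "\<exists>f. isometric_embedding S e Q d f"
proof -
  let ?P = "\<lambda>n f. isometric_embedding (S \<inter> {..<n}) e Q d f"
  have "\<exists>f. \<forall>n. ?P n (f n) \<and> (\<forall>x\<in>S \<inter> {..<n}. f (Suc n) x = f n x)"
  proof (rule dependent_nat_choice)
    show "\<exists>f. ?P 0 f" by (simp add: isometric_embedding_def)
    fix f n assume f: "?P n f"
    show "\<exists>f'. ?P (Suc n) f' \<and> (\<forall>x\<in>S \<inter> {..<n}. f' x = f x)"
    proof (cases "n \<in> S")
      case True
      then have eq: "S \<inter> {..<Suc n} = insert n (S \<inter> {..<n})" by auto
      then have "gen_metric_space R (insert n (S \<inter> {..<n})) e"
        using e gen_metric_space_subset by (metis inf_le1)
      from extend_embedding[OF _ this f] show ?thesis unfolding eq by blast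
    next
      case False
      then have "S \<inter> {..<Suc n} = S \<inter> {..<n}" by (auto simp: less_Suc_eq)
      then show ?thesis using f by auto
    qed
  qed
  then obtain f where f: "\<And>n. ?P n (f n)" and f_Suc: "\<And>n x. x \<in> S \<Longrightarrow> x < n \<Longrightarrow> f (Suc n) x = f n x"
    by auto
  \<comment> \<open>The point \<open>x\<close> first belongs to the segment
    \<open>{..<Suc x}\<close>, and all later stages keep its value.\<close>
  define g where "g x = f (Suc x) x" for x
  have g: "f n x = g x" if "x \<in> S" "Suc x \<le> n" for n x
    using that(2) by (induction n rule: dec_induct) (use that(1) in \<open>auto simp: g_def f_Suc\<close>)
  have "g x \<in> Q \<and> d (g x) (g y) = e x y" if "x \<in> S" "y \<in> S" for x y
  proof -
    define m where "m = Suc (x + y)"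
    then have "x \<in> S \<inter> {..<m}" "y \<in> S \<inter> {..<m}" "f m x = g x" "f m y = g y"
      using that g by auto
    moreover have "f m z \<in> Q" "d (f m z) (f m w) = e z w" if "z \<in> S \<inter> {..<m}" "w \<in> S \<inter> {..<m}" for z w
      using f[of m] that unfolding isometric_embedding_def by blast+
    ultimately show ?thesis by metis
  qed
  then show ?thesis by (intro exI[of _ g]) (auto simp: isometric_embedding_def)
qed

text \<open>A pseudometric suffices: only the least index in each class of points at distance zero
  is embedded, and every point goes to the image of its representative.\<close>

lemma universal_countable:
  assumes X: "countable X" and D: "gen_pseudometric_space R X D"
  shows "\<exists>f. isometric_embedding X D Q d f"
proof (cases "X = {}")
  case False
  define g where "g = from_nat_into X"
  have g: "range g = X" unfolding g_def using False X by (rule range_from_nat_into)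
  define e where "e m n = D (g m) (g n)" for m n
  have e: "e m n \<in> carrier R" "e m m = \<one>" "e m n = e n m" "e m k \<le> e m n \<otimes> e n k" for m n k
    using D g unfolding e_def gen_pseudometric_space_def by blast+
  \<comment> \<open>Two triangle inequalities show that indices at distance zero have the same
    distances to all others, so distances can be computed on representatives.\<close>
  have e0: "e m k = e n k" if "e m n = \<one>" for m n k
    using e(4)[of m k n] e(4)[of n k m] e(1)[of n k] e(1)[of m k] that e(3)[of m n] by simp
  define r where "r m = (LEAST n. e n m = \<one>)" for m
  have r: "e (r m) m = \<one>" for m unfolding r_def by (rule LeastI[where k = m]) (simp add: e)
  have rr: "r m = r n" if "e m n = \<one>" for m n
    unfolding r_def using e0[OF that] e(3) by metis
  have "gen_metric_space R (range r) e"
    unfolding gen_metric_space_def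
  proof (intro conjI ballI)
    fix x y assume "x \<in> range r" "y \<in> range r"
    then obtain m n where mn: "x = r m" "y = r n" by blast
    have "x = y" if "e x y = \<one>"
    proof -
      have "e m n = \<one>" using that e0[OF r[of m]] e0[OF r[of n]] e(3) unfolding mn by metis
      then show ?thesis using rr mn by simp
    qed
    then show "(e x y = \<one>) = (x = y)" using e(2) by blast
  qed (rule e(1) e(3) e(4))+
  then obtain f where f: "isometric_embedding (range r) e Q d f" using universal_nat[of "range r" e] by blast
  define F where "F x = f (r (to_nat_on X x))" for x
  have gt: "g (to_nat_on X x) = x" if "x \<in> X" for x
    unfolding g_def using X that by (rule from_nat_into_to_nat_on)
  have "d (F x) (F y) = D x y" if "x \<in> X" "y \<in> X" for x y
  proof -
    let ?x = "to_nat_on X x" and ?y = "to_nat_on X y"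
    have "d (F x) (F y) = e (r ?x) (r ?y)" using f unfolding F_def isometric_embedding_def by blast
    also have "\<dots> = e ?x ?y" using e0[OF r[of ?x]] e0[OF r[of ?y]] e(3) by metis
    finally show ?thesis unfolding e_def using gt that by simp
  qed
  moreover have "F ` X \<subseteq> Q" using f unfolding F_def isometric_embedding_def by blast
  ultimately show ?thesis unfolding isometric_embedding_def by blast
qed (simp add: isometric_embedding_def)

end

section \<open>Amalgams of two copies of a countable Urysohn space\<close>

context countable_urysohn begin

text \<open>Free amalgam of two copies of \<open>Q\<close> over \<open>x\<close>: the boolean names
  the copy, and points of different copies are joined by a path through \<open>x\<close>. The two
  copies of \<open>x\<close> get distance zero.\<close>

lemma fan:
  assumes x: "x \<in> Q"
  obtains \<mu> \<nu> where "isometric_embedding Q d Q d \<mu>" "isometric_embedding Q d Q d \<nu>"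
    "\<mu> x = x" "\<nu> x = x" "\<And>u v. u \<in> Q \<Longrightarrow> v \<in> Q \<Longrightarrow> d (\<mu> u) x \<le> d (\<mu> u) (\<nu> v)"
proof -
  define D where "D = (\<lambda>(u, b :: bool) (v, c). if b = c then d u v else d u x \<otimes> d x v)"
  have "gen_pseudometric_space R (Q \<times> UNIV) D"
    unfolding gen_pseudometric_space_def
  proof (intro conjI ballI)
    fix p q r assume "p \<in> Q \<times> (UNIV :: bool set)" "q \<in> Q \<times> (UNIV :: bool set)" "r \<in> Q \<times> (UNIV :: bool set)"
    then obtain u a v b w c where pqr: "p = (u, a)" "q = (v, b)" "r = (w, c)" and Q: "u \<in> Q" "v \<in> Q" "w \<in> Q"
      by blast
    note cl = dist_closed[OF Q(1) Q(2)] dist_closed[OF Q(1) Q(3)] dist_closed[OF Q(2) Q(3)]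
      dist_closed[OF Q(1) x] dist_closed[OF x Q(2)] dist_closed[OF Q(2) x] dist_closed[OF x Q(3)]
    show "D p q \<in> carrier R" using cl by (simp add: D_def pqr)
    show "D p q = D q p" using Q x dist_commute m_comm cl by (simp add: D_def pqr)
    show "D p p = \<one>" using Q dist_eq_one by (simp add: D_def pqr)
    consider "a = b" "b = c" | "a = b" "b \<noteq> c" | "a \<noteq> b" "b = c" | "a \<noteq> b" "b \<noteq> c" "a = c" by blast
    then show "D p r \<le> D p q \<otimes> D q r"
    proof cases
      case 1
      then show ?thesis using triangle Q by (simp add: D_def pqr)
    next
      case 2
      have "d u x \<otimes> d x w \<le> (d u v \<otimes> d v x) \<otimes> d x w"
        using cl Q x triangle by (intro add_mono) auto
      then show ?thesis using 2 cl by (simp add: D_def pqr m_assoc)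
    next
      case 3
      have "d u x \<otimes> d x w \<le> d u x \<otimes> (d x v \<otimes> d v w)"
        using cl Q x triangle by (intro add_mono2) auto
      then show ?thesis using 3 cl by (simp add: D_def pqr m_assoc)
    next
      case 4
      \<comment> \<open>A detour into the other copy passes through \<open>x\<close> both on the way
        out and on the way back, so it is no shorter than the path from \<open>u\<close> through
        \<open>x\<close> to \<open>w\<close>.\<close>
      have "d u w \<le> d u x \<otimes> d x w" using Q x triangle by auto
      also have "\<dots> \<le> d u x \<otimes> (d x v \<otimes> (d v x \<otimes> d x w))"
        using cl triangle[OF x Q(2,3)] by (intro add_mono2 le_add2 order_trans[OF triangle[OF x Q(2,3)]]) (auto intro: triangle Q x)
      finally show ?thesis using 4 cl by (simp add: D_def pqr m_assoc)
    qed
  qed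
  then obtain F where F: "isometric_embedding (Q \<times> UNIV) D Q d F"
    using universal_countable[of "Q \<times> UNIV" D] countable_Q by auto
  then have FQ: "F (u, b) \<in> Q" and Fd: "v \<in> Q \<Longrightarrow> d (F (u, b)) (F (v, c)) = D (u, b) (v, c)" if "u \<in> Q" for u b v c
    using that unfolding isometric_embedding_def by auto
  have glue: "F (x, True) = F (x, False)"
    using Fd[OF x x, of True False] dist_eq_one[OF FQ[OF x] FQ[OF x]] dist_eq_one[OF x x] by (simp add: D_def)
  \<comment> \<open>The embedding \<open>F\<close> may send \<open>x\<close> anywhere; homogeneity
    moves its image back to \<open>x\<close>.\<close>
  have "isometry_between {F (x, True)} d {x} d (\<lambda>_. x)"
    using x dist_eq_one[OF x x] dist_eq_one[OF FQ[OF x, of True] FQ[OF x, of True]]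
    unfolding isometry_between_def isometric_embedding_def by simp
  then obtain g where g: "isometry_between Q d Q d g" "g (F (x, True)) = x"
    using homogeneous[of "{F (x, True)}" "{x}" "\<lambda>_. x"] FQ x by auto
  then have gd: "g u \<in> Q" "v \<in> Q \<Longrightarrow> d (g u) (g v) = d u v" if "u \<in> Q" for u v
    using that unfolding isometry_between_def isometric_embedding_def by auto
  show ?thesis
  proof
    show "isometric_embedding Q d Q d (\<lambda>u. g (F (u, True)))" "isometric_embedding Q d Q d (\<lambda>u. g (F (u, False)))"
      using FQ gd Fd by (auto simp: isometric_embedding_def D_def)
    show "g (F (x, True)) = x" "g (F (x, False)) = x" using g glue by simp_all
    fix u v assume uv: "u \<in> Q" "v \<in> Q"
    have "d (g (F (u, True))) x = d u x"
      using gd(2)[OF FQ FQ, of u x True True] uv x Fd[of u x True True] g(2) by (simp add: D_def)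
    also have "\<dots> \<le> d u x \<otimes> d x v" using le_add dist_closed uv x by blast
    also have "\<dots> = d (g (F (u, True))) (g (F (v, False)))"
      using gd(2)[OF FQ FQ, of u v True False] uv Fd[of u v True False] by (simp add: D_def)
    finally show "d (g (F (u, True))) x \<le> d (g (F (u, True))) (g (F (v, False)))" .
  qed
qed

text \<open>
  The amalgam consists of two copies of \<open>Q\<close> at distance \<open>max (d u v) (max (h u) (h v))\<close>, where \<open>h u\<close> is the least \<open>t\<close> with
  \<open>\<epsilon> \<le> t \<oplus> d a u\<close>. The triangle inequality only uses that \<open>h\<close> is 1-Lipschitz, and the copies of
  \<open>u\<close> are identified precisely where \<open>h\<close> vanishes.
\<close>

lemma split_near_point:
  assumes complete: "metrically_complete R" and a: "a \<in> Q" and \<epsilon>: "\<epsilon> \<in> carrier R"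
  obtains \<alpha> \<beta> where "isometric_embedding Q d Q d \<alpha>" "isometric_embedding Q d Q d \<beta>"
    "\<And>u. u \<in> Q \<Longrightarrow> \<epsilon> \<le> d (\<alpha> u) (\<beta> u) \<otimes> d a u"
    "\<And>u. u \<in> Q \<Longrightarrow> \<epsilon> \<le> d a u \<Longrightarrow> \<alpha> u = \<beta> u"
proof -
  have "\<exists>t\<in>carrier R. \<epsilon> \<le> t \<otimes> d a u \<and> (\<forall>t'\<in>carrier R. \<epsilon> \<le> t' \<otimes> d a u \<longrightarrow> t \<le> t')" if "u \<in> Q" for u
  \<comment> \<open>Metric completeness covers \<open>d a u \<le> \<epsilon>\<close>; beyond that,
    \<open>\<one>\<close> is already the least solution.\<close>
  proof (cases "d a u \<le> \<epsilon>")
    case True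
    then show ?thesis using complete \<epsilon> dist_closed[OF a that] unfolding metrically_complete_def by blast
  next
    case False
    then show ?thesis using dist_closed[OF a that] one_le by (intro bexI[of _ \<one>]) auto
  qed
  then obtain h where h: "\<And>u. u \<in> Q \<Longrightarrow> h u \<in> carrier R" "\<And>u. u \<in> Q \<Longrightarrow> \<epsilon> \<le> h u \<otimes> d a u"
    "\<And>u t. u \<in> Q \<Longrightarrow> t \<in> carrier R \<Longrightarrow> \<epsilon> \<le> t \<otimes> d a u \<Longrightarrow> h u \<le> t"
    by metis
  have h0: "h u = \<one>" if "u \<in> Q" "\<epsilon> \<le> d a u" for u
    using h(3)[OF that(1), of \<one>] that(2) one_le[OF h(1)[OF that(1)]] dist_closed[OF a that(1)] by simp
  \<comment> \<open>By minimality of \<open>h u\<close> it suffices that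
    \<open>d u v \<otimes> h v\<close> satisfies the condition of which \<open>h u\<close> is the
    least solution.\<close>
  have lip: "h u \<le> d u v \<otimes> h v" if uv: "u \<in> Q" "v \<in> Q" for u v
  proof (rule h(3))
    note cl = dist_closed[OF uv] dist_closed[OF a uv(1)] dist_closed[OF a uv(2)] h(1)[OF uv(1)] h(1)[OF uv(2)]
    have "h v \<otimes> d a v \<le> h v \<otimes> (d a u \<otimes> d u v)"
      using cl triangle[OF a uv] by (intro add_mono2) auto
    also have "\<dots> = (d u v \<otimes> h v) \<otimes> d a u" using cl by (simp add: m_ac)
    finally show "\<epsilon> \<le> (d u v \<otimes> h v) \<otimes> d a u" using h(2)[OF uv(2)] by simp
  qed (use uv h dist_closed in auto)
  define D where "D = (\<lambda>(u, b :: bool) (v, c). if b = c then d u v else max (d u v) (max (h u) (h v)))"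
  have "gen_pseudometric_space R (Q \<times> UNIV) D"
    unfolding gen_pseudometric_space_def
  proof (intro conjI ballI)
    fix p q r assume "p \<in> Q \<times> (UNIV :: bool set)" "q \<in> Q \<times> (UNIV :: bool set)" "r \<in> Q \<times> (UNIV :: bool set)"
    then obtain u a' v b w c where pqr: "p = (u, a')" "q = (v, b)" "r = (w, c)" and Q: "u \<in> Q" "v \<in> Q" "w \<in> Q"
      by blast
    have cl: "D (u, a') (v, b) \<in> carrier R" if "u \<in> Q" "v \<in> Q" for u v a' b
      using that dist_closed h(1) by (simp add: D_def max_def)
    show "D p q \<in> carrier R" using cl Q by (simp add: pqr)
    show "D p q = D q p" using Q dist_commute by (simp add: D_def pqr max.commute)
    show "D p p = \<one>" using Q dist_eq_one by (simp add: D_def pqr)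
    have le: "d u v \<le> D (u, a') (v, b)" for u v a' b by (simp add: D_def)
    have hl: "h u \<le> D (u, a') (v, b)" "h v \<le> D (u, a') (v, b)" if "a' \<noteq> b" for u v a' b
      using that by (simp_all add: D_def le_max_iff_disj)
    have sum: "s \<otimes> t \<le> D p q \<otimes> D q r" if "s \<le> D p q" "t \<le> D q r" "s \<in> carrier R" "t \<in> carrier R" for s t
      using that cl Q unfolding pqr by (intro add_mono2) auto
    have "d u w \<le> D p q \<otimes> D q r"
      using triangle[OF Q] sum[of "d u v" "d v w"] le dist_closed Q unfolding pqr by (meson order_trans)
    \<comment> \<open>Exactly one of the two legs changes the copy. It dominates \<open>h\<close> at
      both of its ends, and the Lipschitz property carries this along the other leg to the remaining
      endpoint.\<close>
    moreover have "h u \<le> D p q \<otimes> D q r \<and> h w \<le> D p q \<otimes> D q r" if "a' \<noteq> c"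
    proof (cases "a' = b")
      case True
      then have "h v \<le> D q r" "h w \<le> D q r" using hl that unfolding pqr by auto
      moreover from this have "d u v \<otimes> h v \<le> D p q \<otimes> D q r"
        using le dist_closed h(1) Q by (intro sum) (auto simp: pqr)
      moreover have "D q r \<le> D p q \<otimes> D q r" using le_add2 cl Q unfolding pqr by auto
      ultimately show ?thesis using lip[OF Q(1,2)] by (intro conjI; order)
    next
      case False
      then have "h u \<le> D p q" "h v \<le> D p q" using hl unfolding pqr by auto
      moreover from this have "h v \<otimes> d v w \<le> D p q \<otimes> D q r"
        using le dist_closed h(1) Q by (intro sum) (auto simp: pqr)
      moreover have "h v \<otimes> d v w = d w v \<otimes> h v" 
        using m_comm dist_closed h(1) Q dist_commute[of v w] by simp
      moreover have "D p q \<le> D p q \<otimes> D q r" using le_add cl Q unfolding pqr by auto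
      ultimately show ?thesis using lip[OF Q(3,2)] by (intro conjI; order)
    qed
    ultimately show "D p r \<le> D p q \<otimes> D q r"
      by (subst D_def) (auto simp: pqr)
  qed
  then obtain F where F: "isometric_embedding (Q \<times> UNIV) D Q d F"
    using universal_countable[of "Q \<times> UNIV" D] countable_Q by auto
  then have FQ: "F (u, b) \<in> Q" and Fd: "v \<in> Q \<Longrightarrow> d (F (u, b)) (F (v, c)) = D (u, b) (v, c)" if "u \<in> Q" for u b v c
    using that unfolding isometric_embedding_def by auto
  have dh: "d (F (u, True)) (F (u, False)) = h u" if "u \<in> Q" for u
    using Fd[OF that that, of True False] dist_eq_one[OF that that] one_le[OF h(1)[OF that]] by (simp add: D_def max_absorb2)
  show ?thesis
  proof
    show "isometric_embedding Q d Q d (\<lambda>u. F (u, True))" "isometric_embedding Q d Q d (\<lambda>u. F (u, False))"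
      using FQ Fd by (auto simp: isometric_embedding_def D_def)
    fix u assume u: "u \<in> Q"
    show "\<epsilon> \<le> d (F (u, True)) (F (u, False)) \<otimes> d a u" using dh h u by simp
    show "F (u, True) = F (u, False)" if "\<epsilon> \<le> d a u"
      using dh[OF u] h0[OF u that] dist_eq_one FQ u by simp
  qed
qed

text \<open>The copies are indexed by the distances themselves, with cross distance
  \<open>max (d u v) (max i j)\<close>. The copies of a point with indices \<open>\<one>\<close> and
  \<open>\<epsilon>\<close> are then exactly \<open>\<epsilon>\<close> apart, so a single
  \<open>\<alpha>\<close> serves all \<open>\<epsilon>\<close>. Countability of the carrier keeps
  the amalgam countable.\<close>

lemma parallel_copies:
  assumes "countable (carrier R)"
  obtains \<alpha> where "isometric_embedding Q d Q d \<alpha>"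
    "\<And>\<epsilon>. \<epsilon> \<in> carrier R \<Longrightarrow> \<exists>\<beta>. isometric_embedding Q d Q d \<beta> \<and> (\<forall>u\<in>Q. d (\<alpha> u) (\<beta> u) = \<epsilon>)"
proof -
  define D where "D = (\<lambda>(u, i) (v, j). if i = j then d u v else max (d u v) (max i j))"
  have "gen_pseudometric_space R (Q \<times> carrier R) D"
    unfolding gen_pseudometric_space_def
  proof (intro conjI ballI)
    fix p q r assume "p \<in> Q \<times> carrier R" "q \<in> Q \<times> carrier R" "r \<in> Q \<times> carrier R"
    then obtain u i v j w k where pqr: "p = (u, i)" "q = (v, j)" "r = (w, k)" and Q: "u \<in> Q" "v \<in> Q" "w \<in> Q"
      and c: "i \<in> carrier R" "j \<in> carrier R" "k \<in> carrier R"
      by blast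
    have cl: "D (u, i) (v, j) \<in> carrier R" if "u \<in> Q" "v \<in> Q" "i \<in> carrier R" "j \<in> carrier R" for u v i j
      using that dist_closed by (simp add: D_def max_def)
    show "D p q \<in> carrier R" using cl Q c by (simp add: pqr)
    show "D p q = D q p" using Q dist_commute by (simp add: D_def pqr max.commute)
    show "D p p = \<one>" using Q dist_eq_one by (simp add: D_def pqr)
    have le: "d u v \<le> D (u, i) (v, j)" for u v i j by (simp add: D_def)
    have hl: "i \<le> D (u, i) (v, j)" "j \<le> D (u, i) (v, j)" if "i \<noteq> j" for u v i j
      using that by (simp_all add: D_def le_max_iff_disj)
    have "d u v \<otimes> d v w \<le> D p q \<otimes> D q r"
      using le cl dist_closed Q c unfolding pqr by (intro add_mono2) auto
    then have "d u w \<le> D p q \<otimes> D q r" using triangle[OF Q] by order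
    moreover have "D p q \<le> D p q \<otimes> D q r" "D q r \<le> D p q \<otimes> D q r"
      using le_add le_add2 cl Q c unfolding pqr by auto
    \<comment> \<open>If \<open>i \<noteq> k\<close>, each of them is an end of a leg along which
      the index changes, and is at most the length of that leg.\<close>
    moreover have "i \<le> D p q \<or> i \<le> D q r" "k \<le> D p q \<or> k \<le> D q r" if "i \<noteq> k"
      using hl that unfolding pqr by metis+
    ultimately show "D p r \<le> D p q \<otimes> D q r"
      by (subst D_def) (auto simp: pqr)
  qed
  then obtain F where F: "isometric_embedding (Q \<times> carrier R) D Q d F"
    using universal_countable[of "Q \<times> carrier R" D] countable_Q assms by auto
  then have FQ: "F (u, i) \<in> Q" and Fd: "v \<in> Q \<Longrightarrow> j \<in> carrier R \<Longrightarrow> d (F (u, i)) (F (v, j)) = D (u, i) (v, j)"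
    if "u \<in> Q" "i \<in> carrier R" for u i v j
    using that unfolding isometric_embedding_def by auto
  have emb: "isometric_embedding Q d Q d (\<lambda>u. F (u, i))" if "i \<in> carrier R" for i
    using FQ Fd that by (auto simp: isometric_embedding_def D_def)
  have "d (F (u, \<one>)) (F (u, \<epsilon>)) = \<epsilon>" if "u \<in> Q" "\<epsilon> \<in> carrier R" for u \<epsilon>
    using Fd[OF that(1) one_closed that] one_le[OF that(2)] dist_eq_one[OF that(1,1)]
    by (auto simp: D_def max_absorb2)
  then show ?thesis using that[of "\<lambda>u. F (u, \<one>)"] emb by blast
qed

end

section \<open>Countable Urysohn spaces\<close>

lemma countable_urysohn_tau_mpw:
  fixes d :: "'u \<Rightarrow> 'u \<Rightarrow> 'r::linorder"
  assumes R: "distance_monoid R" "countable (carrier R)" "infinite (carrier R)"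
    "metrically_complete R" "standard_monoid R"
    and d: "countable_urysohn_space R UNIV d"
  shows "zariski_topology (IE d) = tau_mpw R d"
    and "strictly_coarser (tau_mpw R d) (tau_pw d)"
    and "minimal_Hausdorff_semigroup_topology (IE d) (tau_mpw R d)"
proof -
  interpret R: distance_monoid R by (rule R)
  interpret U: countable_urysohn R UNIV d by unfold_locales (rule d)
  \<comment> \<open>An infinite carrier contains a nonzero distance, as the topological arguments
    require.\<close>
  have "\<exists>r\<in>carrier R. r \<noteq> \<one>\<^bsub>R\<^esub>"
  proof (rule ccontr)
    assume "\<not> ?thesis"
    then have "carrier R \<subseteq> {\<one>\<^bsub>R\<^esub>}" by blast
    then show False using R(3) finite_subset by blast
  qed
  then interpret D: distance_space R d
    using R(5) U.metric by unfold_locales auto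
  have IE: "f \<in> carrier (IE d)" if "isometric_embedding UNIV d UNIV d f" for f
    using that by (simp add: IE_def)
  show eq: "zariski_topology (IE d) = tau_mpw R d"
  proof (rule D.zariski_eq_tau_mpw)
    fix x \<epsilon> assume \<epsilon>: "\<epsilon> \<in> carrier R" "\<epsilon> \<noteq> \<one>\<^bsub>R\<^esub>"
    obtain \<mu> \<nu> where f: "isometric_embedding UNIV d UNIV d \<mu>" "isometric_embedding UNIV d UNIV d \<nu>"
      "\<mu> x = x" "\<nu> x = x" "\<And>u v. d (\<mu> u) x \<le> d (\<mu> u) (\<nu> v)"
      by (rule U.fan[of x]) auto
    have "d x x < \<epsilon>" using \<epsilon> R.one_less_iff[of \<epsilon>] by (simp add: D.dist_self)
    then show "\<exists>\<mu>\<in>carrier (IE d). \<exists>\<nu>\<in>carrier (IE d). \<exists>p q. \<mu> p = \<nu> q \<and> d x (\<mu> p) < \<epsilon> \<and>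
        (\<forall>u v. d (\<mu> u) (\<mu> p) \<le> d (\<mu> u) (\<nu> v))"
      using IE[OF f(1)] IE[OF f(2)] f(3,4,5) 
      by (intro bexI[of _ \<mu>] bexI[of _ \<nu>] exI[of _ x]) auto
  next
    fix a \<epsilon> assume \<epsilon>: "\<epsilon> \<in> carrier R" "\<epsilon> \<noteq> \<one>\<^bsub>R\<^esub>"
    obtain \<alpha> \<beta> where f: "isometric_embedding UNIV d UNIV d \<alpha>" "isometric_embedding UNIV d UNIV d \<beta>"
      "\<And>u. \<epsilon> \<le> d (\<alpha> u) (\<beta> u) \<otimes>\<^bsub>R\<^esub> d a u" "\<And>u. \<epsilon> \<le> d a u \<Longrightarrow> \<alpha> u = \<beta> u"
      by (rule U.split_near_point[OF R(4) _ \<epsilon>(1), of a]) auto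
    have "\<alpha> a \<noteq> \<beta> a"
    proof
      assume "\<alpha> a = \<beta> a"
      then have "\<epsilon> \<le> \<one>\<^bsub>R\<^esub>"
        using f(3)[of a] by (simp add: D.dist_self)
      then show False using \<epsilon> R.one_less_iff[of \<epsilon>] by simp
    qed
    then show "\<exists>\<alpha>\<in>carrier (IE d). \<exists>\<beta>\<in>carrier (IE d). \<alpha> a \<noteq> \<beta> a \<and> (\<forall>z. \<epsilon> \<le> d a z \<longrightarrow> \<alpha> z = \<beta> z)"
      using IE[OF f(1)] IE[OF f(2)] f(4) by blast
  qed
  obtain \<alpha> where \<alpha>: "isometric_embedding UNIV d UNIV d \<alpha>"
    "\<And>\<epsilon>. \<epsilon> \<in> carrier R \<Longrightarrow> \<exists>\<beta>. isometric_embedding UNIV d UNIV d \<beta> \<and> (\<forall>u. d (\<alpha> u) (\<beta> u) = \<epsilon>)"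
    by (rule U.parallel_copies[OF R(2)]) auto
  have "tau_mpw R d \<noteq> tau_pw d"
  proof (rule D.tau_mpw_neq_tau_pw[OF IE[OF \<alpha>(1)]])
    fix \<epsilon> assume \<epsilon>: "\<epsilon> \<in> carrier R" "\<epsilon> \<noteq> \<one>\<^bsub>R\<^esub>"
    \<comment> \<open>The copies must be strictly closer than \<open>\<epsilon>\<close>, so
      standardness supplies a smaller nonzero distance.\<close>
    obtain \<delta> where \<delta>: "\<delta> \<in> carrier R" "\<delta> \<noteq> \<one>\<^bsub>R\<^esub>" "\<one>\<^bsub>R\<^esub> \<otimes>\<^bsub>R\<^esub> \<delta> < \<epsilon>"
      by (rule D.standardE[OF \<epsilon>(1) R.one_closed]) (use \<epsilon> R.one_less_iff in auto)
    obtain \<beta> where \<beta>: "isometric_embedding UNIV d UNIV d \<beta>" "\<And>u. d (\<alpha> u) (\<beta> u) = \<delta>"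
      using \<alpha>(2)[OF \<delta>(1)] by auto
    have "\<beta> u \<noteq> \<alpha> u \<and> d (\<alpha> u) (\<beta> u) < \<epsilon>" for u
      using \<beta>(2)[of u] \<delta> D.dist_eq_one[of "\<alpha> u" "\<beta> u"] by auto
    then show "\<exists>\<beta>\<in>carrier (IE d). \<forall>u. \<beta> u \<noteq> \<alpha> u \<and> d (\<alpha> u) (\<beta> u) < \<epsilon>"
      using IE[OF \<beta>(1)] by blast
  qed
  then show "strictly_coarser (tau_mpw R d) (tau_pw d)"
    using D.tau_mpw_coarser_tau_pw by (simp add: strictly_coarser_def)
  show "minimal_Hausdorff_semigroup_topology (IE d) (tau_mpw R d)"
    using minimal_if_eq_zariski_topology[OF D.Hausdorff_tau_mpw D.semigroup_topology_tau_mpw eq] .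
qed

section \<open>Completions\<close>

locale completed_space = Metric_space UNIV d for d :: "'u \<Rightarrow> 'u \<Rightarrow> real" +
  fixes Q :: "'u set"
  assumes complete: "mcomplete"
    and closure: "mtopology closure_of Q = UNIV"
begin

lemma dense_point:
  assumes "0 < \<epsilon>"
  obtains q where "q \<in> Q" "d u q < \<epsilon>"
proof -
  have "u \<in> mtopology closure_of Q" using closure by simp
  then show ?thesis using assms that unfolding metric_closure_of by auto
qed

text \<open>The Lipschitz bound by which statements pass from \<open>Q\<close> to the
  completion.\<close>

lemma abs_dist_diff: "\<bar>d x y - d x' y'\<bar> \<le> d x x' + d y y'"
proof -
  have "d x y \<le> d x x' + (d x' y' + d y' y)"
    using triangle[of x x' y] triangle[of x' y' y] by simp
  moreover have "d x' y' \<le> d x' x + (d x y + d y y')"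
    using triangle[of x' x y'] triangle[of x y y'] by simp
  ultimately show ?thesis using commute[of x' x] commute[of y' y] by simp
qed

text \<open>The value at \<open>u\<close> is characterised by its distances to all
  \<open>f q\<close>. This gives agreement with \<open>f\<close> on \<open>Q\<close> at once, and
  density then makes the extension isometric.\<close>

lemma extend_isometric_embedding:
  assumes f: "isometric_embedding Q d Q d f"
  obtains F where "F \<in> carrier (IE d)" "\<And>q. q \<in> Q \<Longrightarrow> F q = f q"
proof -
  have fd: "d (f q) (f q') = d q q'" if "q \<in> Q" "q' \<in> Q" for q q'
    using f that unfolding isometric_embedding_def by blast
  have "\<exists>y. \<forall>q\<in>Q. d y (f q) = d u q" for u
  proof -
    have "\<exists>q\<in>Q. d u q < 1 / Suc n" for n
      using dense_point[of "1 / Suc n" u] by auto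
    \<comment> \<open>The images of a sequence in \<open>Q\<close> converging to \<open>u\<close>
      form a Cauchy sequence because \<open>f\<close> is isometric; their limit has the required
      distances.\<close>
    then obtain s where s: "\<And>n. s n \<in> Q" "\<And>n. d u (s n) < 1 / Suc n" by metis
    have lim: "(\<lambda>n. d u (s n)) \<longlonglongrightarrow> 0"
      using s(2) by (intro tendsto_sandwich[OF _ _ tendsto_const LIMSEQ_inverse_real_of_nat])
        (auto intro!: always_eventually less_imp_le simp: inverse_eq_divide)
    have "MCauchy (\<lambda>n. f (s n))"
      unfolding MCauchy_def
    proof (intro conjI allI impI)
      fix \<epsilon> :: real assume "0 < \<epsilon>"
      then obtain N where N: "\<And>n. N \<le> n \<Longrightarrow> d u (s n) < \<epsilon> / 2"
        using order_tendstoD(2)[OF lim, of "\<epsilon> / 2"] by (auto simp: eventually_sequentially)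
      have "d (f (s m)) (f (s n)) < \<epsilon>" if "N \<le> m" "N \<le> n" for m n
        using N[OF that(1)] N[OF that(2)] triangle[of "s m" u "s n"] commute[of "s m" u] fd[OF s(1,1), of m n]
        by simp
      then show "\<exists>N. \<forall>n n'. N \<le> n \<longrightarrow> N \<le> n' \<longrightarrow> d (f (s n)) (f (s n')) < \<epsilon>" by blast
    qed simp
    then obtain y where y: "limitin mtopology (\<lambda>n. f (s n)) y sequentially"
      using complete unfolding mcomplete_def by blast
    then have ylim: "(\<lambda>n. d (f (s n)) y) \<longlonglongrightarrow> 0" by (simp add: limitin_metric_dist_null)
    have "d y (f q) = d u q" if q: "q \<in> Q" for q
    proof -
      have "\<bar>d y (f q) - d u q\<bar> \<le> d (f (s n)) y + d u (s n)" for n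
        using abs_dist_diff[of y "f q" "f (s n)" "f q"] abs_dist_diff[of "s n" q u q]
          fd[OF s(1) q, of n] commute[of y "f (s n)"] commute[of "s n" u] by simp
      then have "\<forall>\<^sub>F n in sequentially. norm (d y (f q) - d u q) \<le> d (f (s n)) y + d u (s n)" by simp
      moreover have "(\<lambda>n. d (f (s n)) y + d u (s n)) \<longlonglongrightarrow> 0" using tendsto_add[OF ylim lim] by simp
      ultimately have "(\<lambda>n. d y (f q) - d u q) \<longlonglongrightarrow> 0" by (rule Lim_null_comparison)
      then show ?thesis by (simp add: LIMSEQ_const_iff)
    qed
    then show ?thesis by blast
  qed
  then obtain F where F: "\<And>u q. q \<in> Q \<Longrightarrow> d (F u) (f q) = d u q" by metis
  have "F q = f q" if "q \<in> Q" for q using F[OF that, of q] by simp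
  moreover have "d (F u) (F v) = d u v" for u v
  proof (rule ccontr)
    assume "d (F u) (F v) \<noteq> d u v"
    \<comment> \<open>Replacing \<open>v\<close> by \<open>q\<close> and \<open>F v\<close> by
      \<open>f q\<close> changes each distance by at most \<open>d v q\<close>, and the replaced
      distances are equal.\<close>
    then obtain q where q: "q \<in> Q" "d v q < \<bar>d (F u) (F v) - d u v\<bar> / 2"
      using dense_point[of "\<bar>d (F u) (F v) - d u v\<bar> / 2" v] by auto
    show False
      using abs_dist_diff[of "F u" "F v" "F u" "f q"] abs_dist_diff[of u v u q] F[OF q(1)] q(2) by simp
  qed
  then have "F \<in> carrier (IE d)" by (simp add: IE_def isometric_embedding_def)
  ultimately show ?thesis using that by blast
qed

end

text \<open>\<open>R0\<close> measures the dense countable space, \<open>R\<close> its completion.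
  \<open>sub\<close> covers ordinary and truncated addition alike, and \<open>rats\<close> provides
  arbitrarily small nonzero distances in \<open>R0\<close>.\<close>

lemma completed_urysohn_tau_mpw:
  fixes d :: "'u \<Rightarrow> 'u \<Rightarrow> real"
  assumes R0: "distance_monoid R0" "countable (carrier R0)" "metrically_complete R0" "one R0 = 0"
    and sub: "\<And>r s. mult R0 r s \<le> r + s"
    and rats: "\<And>\<epsilon>. \<epsilon> \<in> \<rat> \<Longrightarrow> 0 < \<epsilon> \<Longrightarrow> \<epsilon> \<le> 1 \<Longrightarrow> \<epsilon> \<in> carrier R0"
    and Q: "countable_urysohn_space R0 Q d" "completion_of Q d"
    and R: "distance_monoid R" "standard_monoid R" "one R = 0" "1 \<in> carrier R" "gen_metric_space R UNIV d"
  shows "zariski_topology (IE d) = tau_mpw R d"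
    and "strictly_coarser (tau_mpw R d) (tau_pw d)"
    and "minimal_Hausdorff_semigroup_topology (IE d) (tau_mpw R d)"
proof -
  interpret Q: distance_monoid R0 by (rule R0)
  interpret Q: countable_urysohn R0 Q d by unfold_locales (rule Q)
  interpret M: Metric_space UNIV d using Q(2) by (simp add: completion_of_def)
  interpret M: completed_space d Q using Q(2) by unfold_locales (simp_all add: completion_of_def)
  interpret R: distance_monoid R by (rule R)
  interpret D: distance_space R d using R by unfold_locales (auto intro!: bexI[of _ 1])
  have pos: "0 < \<epsilon>" if "\<epsilon> \<in> carrier R" "\<epsilon> \<noteq> \<one>\<^bsub>R\<^esub>" for \<epsilon>
    using that R.one_less_iff[of \<epsilon>] R(3) by simp
  have rat: "\<exists>\<delta>\<in>\<rat>. 0 < \<delta> \<and> \<delta> \<le> 1 \<and> \<delta> < \<epsilon>" if "0 < \<epsilon>" for \<epsilon> :: real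
  proof -
    have "0 < min 1 \<epsilon>" using that by simp
    then obtain \<delta> where "\<delta> \<in> \<rat>" "0 < \<delta>" "\<delta> < min 1 \<epsilon>" using Rats_dense_in_real by blast
    then show ?thesis by (intro bexI[of _ \<delta>]) auto
  qed
  have isom: "d (F u) (F v) = d u v" if "F \<in> carrier (IE d)" for F u v
    using that D.carrier_IE by blast
  have close: "\<bar>d (F u) (G v) - d (F p) (G q)\<bar> \<le> d u p + d v q"
    if "F \<in> carrier (IE d)" "G \<in> carrier (IE d)" for F G u v p q
    using M.abs_dist_diff[of "F u" "G v" "F p" "G q"] isom[OF that(1), of u p] isom[OF that(2), of v q] by simp
  show eq: "zariski_topology (IE d) = tau_mpw R d"
  proof (rule D.zariski_eq_tau_mpw)
    fix x \<epsilon> assume "\<epsilon> \<in> carrier R" "\<epsilon> \<noteq> \<one>\<^bsub>R\<^esub>"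
    \<comment> \<open>The point \<open>x\<close> may lie outside \<open>Q\<close>, so the fan is
      built at a nearby point of \<open>Q\<close>.\<close>
    then obtain y where y: "y \<in> Q" "d x y < \<epsilon>" using M.dense_point pos by blast
    obtain m n where f: "isometric_embedding Q d Q d m" "isometric_embedding Q d Q d n"
      "m y = y" "n y = y" "\<And>u v. u \<in> Q \<Longrightarrow> v \<in> Q \<Longrightarrow> d (m u) y \<le> d (m u) (n v)"
      using Q.fan[OF y(1)] by blast
    obtain \<mu> where \<mu>: "\<mu> \<in> carrier (IE d)" "\<And>q. q \<in> Q \<Longrightarrow> \<mu> q = m q" using M.extend_isometric_embedding[OF f(1)] by blast
    obtain \<nu> where \<nu>: "\<nu> \<in> carrier (IE d)" "\<And>q. q \<in> Q \<Longrightarrow> \<nu> q = n q" using M.extend_isometric_embedding[OF f(2)] by blast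
    have "d (\<mu> u) (\<mu> y) \<le> d (\<mu> u) (\<nu> v)" for u v
    proof (rule field_le_epsilon)
      fix e :: real assume e: "0 < e"
      \<comment> \<open>Passing to \<open>p\<close> and \<open>q\<close> costs
        \<open>2 * d u p + d v q\<close>, which is below \<open>e\<close>.\<close>
      obtain p where p: "p \<in> Q" "d u p < e / 4" using M.dense_point[of "e / 4" u] e by auto
      obtain q where q: "q \<in> Q" "d v q < e / 4" using M.dense_point[of "e / 4" v] e by auto
      have "d (\<mu> p) (\<mu> y) \<le> d (\<mu> p) (\<nu> q)" using f(3,5) p q \<mu>(2) \<nu>(2) y by simp
      then show "d (\<mu> u) (\<mu> y) \<le> d (\<mu> u) (\<nu> v) + e"
        using close[OF \<mu>(1) \<mu>(1), of u y p y] close[OF \<mu>(1) \<nu>(1), of u v p q] p(2) q(2) by simp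
    qed
    moreover have "\<mu> y = y" "\<nu> y = y" using f \<mu> \<nu> y by simp_all
    ultimately show "\<exists>\<mu>\<in>carrier (IE d). \<exists>\<nu>\<in>carrier (IE d). \<exists>p q. \<mu> p = \<nu> q \<and> d x (\<mu> p) < \<epsilon> \<and>
        (\<forall>u v. d (\<mu> u) (\<mu> p) \<le> d (\<mu> u) (\<nu> v))"
      using \<mu>(1) \<nu>(1) y(2) by (intro bexI[of _ \<mu>] bexI[of _ \<nu>] exI[of _ y]) auto
  next
    fix a \<epsilon> assume "\<epsilon> \<in> carrier R" "\<epsilon> \<noteq> \<one>\<^bsub>R\<^esub>"
    then have "0 < \<epsilon>" using pos by blast
    \<comment> \<open>Splitting happens at \<open>b\<close> with radius \<open>\<delta>\<close>.
      Then \<open>a\<close> lies inside the ball, while a point at distance at least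
      \<open>\<epsilon>\<close> from \<open>a\<close> is more than
      \<open>\<epsilon> - \<delta> > \<delta>\<close> away from \<open>b\<close>.\<close>
    then obtain \<delta> where \<delta>: "\<delta> \<in> \<rat>" "0 < \<delta>" "\<delta> \<le> 1" "\<delta> < \<epsilon> / 2" using rat[of "\<epsilon> / 2"] by auto
    then obtain b where b: "b \<in> Q" "d a b < \<delta>" using M.dense_point by blast
    obtain f g where f: "isometric_embedding Q d Q d f" "isometric_embedding Q d Q d g"
      "\<And>u. u \<in> Q \<Longrightarrow> \<delta> \<le> mult R0 (d (f u) (g u)) (d b u)" "\<And>u. u \<in> Q \<Longrightarrow> \<delta> \<le> d b u \<Longrightarrow> f u = g u"
      using Q.split_near_point[OF R0(3) b(1) rats[OF \<delta>(1,2,3)]] by blast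
    obtain \<alpha> where \<alpha>: "\<alpha> \<in> carrier (IE d)" "\<And>q. q \<in> Q \<Longrightarrow> \<alpha> q = f q" using M.extend_isometric_embedding[OF f(1)] by blast
    obtain \<beta> where \<beta>: "\<beta> \<in> carrier (IE d)" "\<And>q. q \<in> Q \<Longrightarrow> \<beta> q = g q" using M.extend_isometric_embedding[OF f(2)] by blast
    have "\<alpha> a \<noteq> \<beta> a"
    proof
      assume eq: "\<alpha> a = \<beta> a"
      \<comment> \<open>The error \<open>d a q\<close> is paid three times: once in
        \<open>d b q\<close> and twice in \<open>d (\<alpha> q) (\<beta> q)\<close>.\<close>
      have "0 < (\<delta> - d a b) / 3" using b by simp
      then obtain q where q: "q \<in> Q" "d a q < (\<delta> - d a b) / 3" using M.dense_point by blast
      have "\<delta> \<le> d (\<alpha> q) (\<beta> q) + d b q" using f(3)[OF q(1)] sub \<alpha>(2) \<beta>(2) q(1) by (metis order_trans)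
      moreover have "d b q \<le> d a b + d a q" using M.triangle[of b a q] M.commute[of b a] by simp
      moreover have "d (\<alpha> q) (\<beta> q) \<le> 2 * d a q" using close[OF \<alpha>(1) \<beta>(1), of a a q q] eq by simp
      ultimately show False using q(2) by simp
    qed
    moreover have "\<alpha> z = \<beta> z" if z: "\<epsilon> \<le> d a z" for z
    proof (rule ccontr)
      assume "\<alpha> z \<noteq> \<beta> z"
      then have "0 < d (\<alpha> z) (\<beta> z)" by simp
      moreover have "0 < \<epsilon> - d a b - \<delta>" using b \<delta> by simp
      ultimately have "0 < min (\<epsilon> - d a b - \<delta>) (d (\<alpha> z) (\<beta> z) / 2)" by simp
      \<comment> \<open>The first bound keeps \<open>q\<close> at distance at least
        \<open>\<delta>\<close> from \<open>b\<close>, so \<open>\<alpha>\<close> and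
        \<open>\<beta>\<close> agree at \<open>q\<close>; the second makes the error
        \<open>2 * d z q\<close> too small for them to differ at \<open>z\<close>.\<close>
      then obtain q where q: "q \<in> Q" "d z q < min (\<epsilon> - d a b - \<delta>) (d (\<alpha> z) (\<beta> z) / 2)" using M.dense_point by blast
      have "d a z \<le> d a b + (d b q + d z q)"
        using M.triangle[of a b z] M.triangle[of b q z] M.commute[of q z] by simp
      then have "\<delta> \<le> d b q" using z q(2) by simp
      then have "\<alpha> q = \<beta> q" using f(4) \<alpha>(2) \<beta>(2) q(1) by simp
      then show False using close[OF \<alpha>(1) \<beta>(1), of z z q q] q(2) by simp
    qed
    ultimately show "\<exists>\<alpha>\<in>carrier (IE d). \<exists>\<beta>\<in>carrier (IE d). \<alpha> a \<noteq> \<beta> a \<and> (\<forall>z. \<epsilon> \<le> d a z \<longrightarrow> \<alpha> z = \<beta> z)"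
      using \<alpha>(1) \<beta>(1) by blast
  qed
  obtain f where f: "isometric_embedding Q d Q d f"
    "\<And>\<epsilon>. \<epsilon> \<in> carrier R0 \<Longrightarrow> \<exists>g. isometric_embedding Q d Q d g \<and> (\<forall>u\<in>Q. d (f u) (g u) = \<epsilon>)"
    using Q.parallel_copies[OF R0(2)] by blast
  obtain \<alpha> where \<alpha>: "\<alpha> \<in> carrier (IE d)" "\<And>q. q \<in> Q \<Longrightarrow> \<alpha> q = f q" using M.extend_isometric_embedding[OF f(1)] by blast
  have "tau_mpw R d \<noteq> tau_pw d"
  proof (rule D.tau_mpw_neq_tau_pw[OF \<alpha>(1)])
    fix \<epsilon> assume "\<epsilon> \<in> carrier R" "\<epsilon> \<noteq> \<one>\<^bsub>R\<^esub>"
    then obtain \<delta> where \<delta>: "\<delta> \<in> \<rat>" "0 < \<delta>" "\<delta> \<le> 1" "\<delta> < \<epsilon>" using rat pos by blast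
    obtain g where g: "isometric_embedding Q d Q d g" "\<And>u. u \<in> Q \<Longrightarrow> d (f u) (g u) = \<delta>"
      using f(2)[OF rats[OF \<delta>(1,2,3)]] by blast
    obtain \<beta> where \<beta>: "\<beta> \<in> carrier (IE d)" "\<And>q. q \<in> Q \<Longrightarrow> \<beta> q = g q" using M.extend_isometric_embedding[OF g(1)] by blast
    \<comment> \<open>By continuity the constant displacement on \<open>Q\<close> persists, so no
      point of the completion has equal images.\<close>
    have "d (\<alpha> u) (\<beta> u) = \<delta>" for u
    proof (rule ccontr)
      assume "d (\<alpha> u) (\<beta> u) \<noteq> \<delta>"
      then have "0 < \<bar>d (\<alpha> u) (\<beta> u) - \<delta>\<bar> / 2" by simp
      then obtain q where q: "q \<in> Q" "d u q < \<bar>d (\<alpha> u) (\<beta> u) - \<delta>\<bar> / 2" using M.dense_point by blast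
      have "d (\<alpha> q) (\<beta> q) = \<delta>" using g(2) \<alpha>(2) \<beta>(2) q(1) by simp
      then show False using close[OF \<alpha>(1) \<beta>(1), of u u q q] q(2) by simp
    qed
    then have "\<beta> u \<noteq> \<alpha> u \<and> d (\<alpha> u) (\<beta> u) < \<epsilon>" for u
      using \<delta> M.zero[of "\<alpha> u" "\<beta> u"] by auto
    then show "\<exists>\<beta>\<in>carrier (IE d). \<forall>u. \<beta> u \<noteq> \<alpha> u \<and> d (\<alpha> u) (\<beta> u) < \<epsilon>"
      using \<beta>(1) by blast
  qed
  then show "strictly_coarser (tau_mpw R d) (tau_pw d)"
    using D.tau_mpw_coarser_tau_pw by (simp add: strictly_coarser_def)
  show "minimal_Hausdorff_semigroup_topology (IE d) (tau_mpw R d)"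
    using minimal_if_eq_zariski_topology[OF D.Hausdorff_tau_mpw D.semigroup_topology_tau_mpw eq] .
qed

section \<open>The rational and real distance monoids\<close>

lemma metrically_complete_nonneg_on_rat: "metrically_complete rat_monoid"
  unfolding metrically_complete_def
proof (intro ballI impI)
  fix r s assume "r \<in> carrier rat_monoid" "s \<in> carrier rat_monoid" "s \<le> r"
  then show "\<exists>t\<in>carrier rat_monoid. r \<le> t \<otimes>\<^bsub>rat_monoid\<^esub> s \<and>
      (\<forall>t'\<in>carrier rat_monoid. r \<le> t' \<otimes>\<^bsub>rat_monoid\<^esub> s \<longrightarrow> t \<le> t')"
    by (intro bexI[of _ "r - s"]) (auto simp: nonneg_on_def)
qed

lemma metrically_complete_unit_interval_on_rat: "metrically_complete rat_unit_monoid"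
  unfolding metrically_complete_def
proof (intro ballI impI)
  fix r s assume "r \<in> carrier rat_unit_monoid" "s \<in> carrier rat_unit_monoid" "s \<le> r"
  then show "\<exists>t\<in>carrier rat_unit_monoid. r \<le> t \<otimes>\<^bsub>rat_unit_monoid\<^esub> s \<and>
      (\<forall>t'\<in>carrier rat_unit_monoid. r \<le> t' \<otimes>\<^bsub>rat_unit_monoid\<^esub> s \<longrightarrow> t \<le> t')"
    \<comment> \<open>Truncation leaves the least solution \<open>r - s\<close> unchanged because
      \<open>r \<le> 1\<close>.\<close>
    by (intro bexI[of _ "r - s"]) (auto simp: unit_interval_on_def)
qed

lemma standard_real_monoid: "standard_monoid real_monoid"
  unfolding standard_monoid_def
proof (intro ballI impI)
  fix r s assume "r \<in> carrier real_monoid" "s \<in> carrier real_monoid" "s < r"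
  then show "\<exists>t\<in>carrier real_monoid. t \<noteq> \<one>\<^bsub>real_monoid\<^esub> \<and> s \<otimes>\<^bsub>real_monoid\<^esub> t < r"
    by (intro bexI[of _ "(r - s) / 2"]) (auto simp: nonneg_on_def field_simps)
qed

lemma standard_real_unit_monoid: "standard_monoid real_unit_monoid"
  unfolding standard_monoid_def
proof (intro ballI impI)
  fix r s assume "r \<in> carrier real_unit_monoid" "s \<in> carrier real_unit_monoid" "s < r"
  then show "\<exists>t\<in>carrier real_unit_monoid. t \<noteq> \<one>\<^bsub>real_unit_monoid\<^esub> \<and> s \<otimes>\<^bsub>real_unit_monoid\<^esub> t < r"
    by (intro bexI[of _ "(r - s) / 2"]) (auto simp: unit_interval_on_def min_def field_simps)
qed

lemma gen_metric_space_real: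
  assumes "completion_of Q d"
  shows "gen_metric_space real_monoid UNIV d"
proof -
  interpret Metric_space UNIV d using assms by (simp add: completion_of_def)
  show ?thesis using triangle commute by (auto simp: gen_metric_space_def nonneg_on_def)
qed

text \<open>The bound 1 on distances passes from \<open>Q\<close> to its closure, and with it the
  ordinary triangle inequality implies the truncated one.\<close>

lemma gen_metric_space_real_unit:
  assumes "completion_of Q d" "gen_metric_space rat_unit_monoid Q d"
  shows "gen_metric_space real_unit_monoid UNIV d"
proof -
  interpret Metric_space UNIV d using assms by (simp add: completion_of_def)
  interpret completed_space d Q using assms by unfold_locales (simp_all add: completion_of_def)
  have "d x y \<le> 1" for x y
  proof (rule field_le_epsilon)
    fix e :: real assume e: "0 < e"
    obtain p where p: "p \<in> Q" "d x p < e / 2" using dense_point[of "e / 2" x] e by auto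
    obtain q where q: "q \<in> Q" "d y q < e / 2" using dense_point[of "e / 2" y] e by auto
    have "d p q \<le> 1" using assms(2) p q by (auto simp: gen_metric_space_def unit_interval_on_def)
    then show "d x y \<le> 1 + e" using abs_dist_diff[of x y p q] p q by simp
  qed
  then show ?thesis using triangle commute by (auto simp: gen_metric_space_def unit_interval_on_def)
qed

theorem theorem7p30:
  fixes R :: "'r::linorder monoid"
    and d :: "'u \<Rightarrow> 'u \<Rightarrow> 'r"
    and d2 :: "'v \<Rightarrow> 'v \<Rightarrow> real"
    and d3 :: "'w \<Rightarrow> 'w \<Rightarrow> real"
  shows
    "(distance_monoid R \<and> countable (carrier R) \<and> infinite (carrier R) \<and>
      metrically_complete R \<and> standard_monoid R \<and> countable_urysohn_space R UNIV d \<longrightarrow>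
        zariski_topology (IE d) = tau_mpw R d \<and>
        strictly_coarser (tau_mpw R d) (tau_pw d) \<and>
        minimal_Hausdorff_semigroup_topology (IE d) (tau_mpw R d)) \<and>
     (real_urysohn_space d2 \<longrightarrow>
        zariski_topology (IE d2) = tau_mpw real_monoid d2 \<and>
        strictly_coarser (tau_mpw real_monoid d2) (tau_pw d2) \<and>
        minimal_Hausdorff_semigroup_topology (IE d2) (tau_mpw real_monoid d2)) \<and>
     (real_urysohn_sphere d3 \<longrightarrow>
        zariski_topology (IE d3) = tau_mpw real_unit_monoid d3 \<and>
        strictly_coarser (tau_mpw real_unit_monoid d3) (tau_pw d3) \<and>
        minimal_Hausdorff_semigroup_topology (IE d3) (tau_mpw real_unit_monoid d3))"
proof (intro conjI[of "_ \<longrightarrow> _"] impI)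
  assume "distance_monoid R \<and> countable (carrier R) \<and> infinite (carrier R) \<and>
      metrically_complete R \<and> standard_monoid R \<and> countable_urysohn_space R UNIV d"
  then show "zariski_topology (IE d) = tau_mpw R d \<and> strictly_coarser (tau_mpw R d) (tau_pw d) \<and>
      minimal_Hausdorff_semigroup_topology (IE d) (tau_mpw R d)"
    by (elim conjE) (intro conjI countable_urysohn_tau_mpw)
next
  assume "real_urysohn_space d2"
  then obtain Q where Q: "countable_urysohn_space rat_monoid Q d2" "completion_of Q d2"
    unfolding real_urysohn_space_def by blast
  have "countable (carrier rat_monoid)"
    using countable_rat by (auto simp: nonneg_on_def intro: countable_subset)
  then show "zariski_topology (IE d2) = tau_mpw real_monoid d2 \<and>
      strictly_coarser (tau_mpw real_monoid d2) (tau_pw d2) \<and>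
      minimal_Hausdorff_semigroup_topology (IE d2) (tau_mpw real_monoid d2)"
    using completed_urysohn_tau_mpw[OF distance_monoid_nonneg_on _ metrically_complete_nonneg_on_rat _ _ _ Q
        distance_monoid_nonneg_on standard_real_monoid _ _ gen_metric_space_real[OF Q(2)]]
    by (simp add: nonneg_on_def)
next
  assume "real_urysohn_sphere d3"
  then obtain Q where Q: "countable_urysohn_space rat_unit_monoid Q d3" "completion_of Q d3"
    unfolding real_urysohn_sphere_def by blast
  then have "gen_metric_space rat_unit_monoid Q d3"
    unfolding countable_urysohn_space_def urysohn_space_def by blast
  note metric = gen_metric_space_real_unit[OF Q(2) this]
  have "countable (carrier rat_unit_monoid)"
    using countable_rat by (auto simp: unit_interval_on_def intro: countable_subset)
  then show "zariski_topology (IE d3) = tau_mpw real_unit_monoid d3 \<and>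
      strictly_coarser (tau_mpw real_unit_monoid d3) (tau_pw d3) \<and>
      minimal_Hausdorff_semigroup_topology (IE d3) (tau_mpw real_unit_monoid d3)"
    using completed_urysohn_tau_mpw[OF distance_monoid_unit_interval_on _ metrically_complete_unit_interval_on_rat _ _ _ Q
        distance_monoid_unit_interval_on standard_real_unit_monoid _ _ metric]
    by (simp add: unit_interval_on_def)
qed

end
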